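(* Let $b,v\in C^1(\mathbb R)$ be real-valued and periodic with period $1$, and suppose that $b$ has at least one zero and at most finitely many zeros on its period. Then for every irrational $\alpha$ there exists a subsequence $\frac{p_{n_j}}{q_{n_j}}$ of the canonical approximants of $\alpha$ such that $$|\sigma(M_{v,b,\alpha})|=\lim_{j\to\infty}\left|\sigma\left(M_{v,b,\frac{p_{n_j}}{q_{n_j}}}\right)\right|.$$
   Context: For real $\alpha,\theta$, the Jacobi operator $H_{v,b,\alpha,\theta}$ on $\ell^2(\mathbb Z)$ is $$(H_{v,b,\alpha,\theta}\phi)(n)=b(\theta+(n-1)\alpha)\phi(n-1)+b(\theta+n\alpha)\phi(n+1)+v(\theta+n\alpha)\phi(n),\qquad n\in\mathbb Z.$$ $M_{v,b,\alpha}=\oplus_{\theta\in[0,1)}H_{v,b,\alpha,\theta}$ is the direct sum of these operators over $\theta\in[0,1)$; its spectrum is $\sigma(M_{v,b,\alpha})=\bigcup_{\theta\in[0,1)}\sigma(H_{v,b,\alpha,\theta})$. $|A|$ denotes the Lebesgue measure of $A\subset\mathbb R$. The canonical approximants $p_n/q_n$ (in lowest terms, $n\ge1$) of an irrational $\alpha$ are its continued fraction convergents, i.e. the truncations after $n$ steps of the continued fraction expansion of $\alpha$. *)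

theory Defs
  imports "HOL-Analysis.Analysis"
begin

text \<open>The Hilbert space \<open>\<ell>\<^sup>2(A)\<close>, realised as functions on the whole type that vanish outside \<open>A\<close>.\<close>

definition ell2 :: "'a set \<Rightarrow> ('a \<Rightarrow> complex) set" where
  "ell2 A = {\<phi>. (\<forall>x. x \<notin> A \<longrightarrow> \<phi> x = 0) \<and> (\<lambda>x. (norm (\<phi> x))\<^sup>2) summable_on A}"

definition ell2_norm :: "'a set \<Rightarrow> ('a \<Rightarrow> complex) \<Rightarrow> real" where
  "ell2_norm A \<phi> = sqrt (infsum (\<lambda>x. (norm (\<phi> x))\<^sup>2) A)"

text \<open>\<open>z\<close> is in the resolvent set iff \<open>T - z\<close> is a bijection of \<open>\<ell>\<^sup>2(A)\<close> whose inverse is bounded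
  (the inequality below, read on the range of \<open>T - z\<close>); the spectrum is the complement.\<close>

definition ell2_spectrum :: "'a set \<Rightarrow> (('a \<Rightarrow> complex) \<Rightarrow> 'a \<Rightarrow> complex) \<Rightarrow> complex set" where
  "ell2_spectrum A T =
     {z. \<not> (bij_betw (\<lambda>\<phi> x. T \<phi> x - z * \<phi> x) (ell2 A) (ell2 A) \<and>
            (\<exists>C. \<forall>\<phi>\<in>ell2 A. ell2_norm A \<phi> \<le> C * ell2_norm A (\<lambda>x. T \<phi> x - z * \<phi> x)))}"

definition jacobi :: "(real \<Rightarrow> real) \<Rightarrow> (real \<Rightarrow> real) \<Rightarrow> real \<Rightarrow> real \<Rightarrow> (int \<Rightarrow> complex) \<Rightarrow> int \<Rightarrow> complex" where
  "jacobi v b \<alpha> \<theta> \<phi> n =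
     complex_of_real (b (\<theta> + of_int (n - 1) * \<alpha>)) * \<phi> (n - 1)
   + complex_of_real (b (\<theta> + of_int n * \<alpha>)) * \<phi> (n + 1)
   + complex_of_real (v (\<theta> + of_int n * \<alpha>)) * \<phi> n"

text \<open>The Hilbert space direct sum of copies of \<open>\<ell>\<^sup>2(\<int>)\<close> over \<open>\<theta> \<in> [0,1)\<close> is identified with
  \<open>\<ell>\<^sup>2([0,1) \<times> \<int>)\<close>; the direct sum operator acts by \<open>jacobi v b \<alpha> \<theta>\<close> on the fibre over \<open>\<theta>\<close>.\<close>

definition jacobi_index :: "(real \<times> int) set" where
  "jacobi_index = {0..<1} \<times> UNIV"

definition jacobi_sum ::
  "(real \<Rightarrow> real) \<Rightarrow> (real \<Rightarrow> real) \<Rightarrow> real \<Rightarrow> (real \<times> int \<Rightarrow> complex) \<Rightarrow> real \<times> int \<Rightarrow> complex" where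
  "jacobi_sum v b \<alpha> \<phi> =
     (\<lambda>(\<theta>, n). if \<theta> \<in> {0..<1} then jacobi v b \<alpha> \<theta> (\<lambda>m. \<phi> (\<theta>, m)) n else 0)"

text \<open>The direct sum is self-adjoint for bounded real \<open>v\<close> and \<open>b\<close>, so restricting the spectrum
  to the real line loses nothing.\<close>

definition jacobi_sum_spectrum :: "(real \<Rightarrow> real) \<Rightarrow> (real \<Rightarrow> real) \<Rightarrow> real \<Rightarrow> real set" where
  "jacobi_sum_spectrum v b \<alpha> =
     {E. complex_of_real E \<in> ell2_spectrum jacobi_index (jacobi_sum v b \<alpha>)}"

text \<open>\<open>cf_convergent n \<alpha>\<close> is \<open>[a\<^sub>0; a\<^sub>1, \<dots>, a\<^sub>n]\<close>. It is meant for irrational \<open>\<alpha>\<close>, where the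
  expansion never terminates and no division by zero occurs.\<close>

fun cf_convergent :: "nat \<Rightarrow> real \<Rightarrow> real" where
  "cf_convergent 0 x = of_int \<lfloor>x\<rfloor>"
| "cf_convergent (Suc n) x = of_int \<lfloor>x\<rfloor> + 1 / cf_convergent n (1 / frac x)"

end

theory Submission imports Defs
begin

text \<open>
  Every fibre is a Jacobi matrix, hence self-adjoint, and \<open>E\<close> lies in the spectrum of the direct sum
  iff some finitely supported vectors in the fibres are approximate eigenvectors for \<open>E\<close>.

  Let \<open>E\<close> be in the spectrum at frequency \<open>\<alpha>\<close>. An approximate eigenvector may be cut off at a slope
  proportional to \<open>1 / |b|\<close> with an error \<open>O(1/W)\<close> if \<open>\<Sum> 1 / |b(\<theta> + k \<alpha>)| \<ge> W\<close> over each window of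
  length \<open>L\<close>; on such a window the frequency \<open>\<alpha>\<close> may be replaced by \<open>\<alpha>'\<close> at the cost
  \<open>O(L |\<alpha> - \<alpha>'|)\<close>. Since \<open>b\<close> is Lipschitz and has a zero, \<open>1 / |b|\<close> is not integrable, and
  \<open>W / L\<close> tends to infinity with \<open>L\<close>. For a convergent \<open>\<alpha>' = p / q\<close> and \<open>L\<close> a small
  multiple of \<open>q\<close>, the spectrum at \<open>\<alpha>\<close> therefore lies in an \<open>o(1/q)\<close>-neighbourhood of
  the spectrum at \<open>p / q\<close>.

  The spectrum at \<open>p / q\<close> has \<open>O(q)\<close> components: each of them meets the spectrum of the fibre
  over a zero of \<open>b\<close>, which decouples into copies of one \<open>q \<times> q\<close> block. Hence the spectrum at \<open>\<alpha>\<close>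
  has measure at most that at \<open>p / q\<close> plus \<open>o(1)\<close>. The reverse inequality is the upper
  semicontinuity of Lebesgue measure on compact sets. No passage to a subsequence is needed.
\<close>

subsection \<open>Approximate spectra of families of symmetric operators\<close>

text \<open>The powers of q are borderline, and this is where the zero of \<open>b\<close> is
  decisive. A cut-off of length L ordinarily costs a multiple of 1/L in energy, and replacing
  \<alpha> by p/q with |\<alpha> - p/q| \<le> 1/q^2 costs a multiple of L/q^2. With L of order q
  both are of order 1/q; multiplied by the O(q) components, each of which may grow at its two ends,
  the total error is bounded but need not vanish. Where |b| is small, cutting is cheap: for L about
  a q the cut-off costs only O(1/(\<omega> a q)), with \<omega> as large as desired. So a is fixed
  first, making the frequency cost small, then \<omega>, and only then is q taken large. In the
  reverse inequality the set being enlarged is the fixed spectrum at \<alpha>, no number of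
  components enters, and any error tending to 0 suffices. The family of all fibres is treated like
  one operator, through bounds uniform in the phase. Approximate eigenvectors with finite support
  keep every sum in the spectral estimates finite.\<close>

definition approx_spectrum :: "'i set \<Rightarrow> ('i \<Rightarrow> 'h \<Rightarrow> 'h::real_inner) \<Rightarrow> real set" where
  "approx_spectrum I T =
     {E. \<forall>c>0. \<exists>i\<in>I. \<exists>u. u \<noteq> 0 \<and> norm (T i u - E *\<^sub>R u) \<le> c * norm u}"

lemma approx_spectrumI:
  assumes "\<And>c. c > 0 \<Longrightarrow> \<exists>i\<in>I. \<exists>u. u \<noteq> 0 \<and> norm (T i u - E *\<^sub>R u) \<le> c * norm u"
  shows "E \<in> approx_spectrum I T"
  using assms by (auto simp: approx_spectrum_def)

lemma approx_spectrumD: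
  assumes "E \<in> approx_spectrum I T" "c > 0"
  obtains i u where "i \<in> I" "u \<noteq> 0" "norm (T i u - E *\<^sub>R u) \<le> c * norm u"
  using assms by (auto simp: approx_spectrum_def)

lemma not_approx_spectrumD:
  assumes "E \<notin> approx_spectrum I T"
  obtains c where "c > 0" "\<And>i u. i \<in> I \<Longrightarrow> c * norm u \<le> norm (T i u - E *\<^sub>R u)"
proof -
  obtain c where c: "c > 0" "\<And>i u. i \<in> I \<Longrightarrow> u \<noteq> 0 \<Longrightarrow> norm (T i u - E *\<^sub>R u) > c * norm u"
    using assms by (auto simp: approx_spectrum_def not_le)
  have "c * norm u \<le> norm (T i u - E *\<^sub>R u)" if "i \<in> I" for i u
    using c(2)[OF that, of u] by (cases "u = 0") auto
  with c(1) that show thesis by blast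
qed

lemma approx_spectrum_mono: "I \<subseteq> J \<Longrightarrow> approx_spectrum I T \<subseteq> approx_spectrum J T"
  unfolding approx_spectrum_def by blast

lemma closed_approx_spectrum: "closed (approx_spectrum I T)"
  unfolding closed_sequential_limits
proof (intro allI impI, elim conjE)
  fix X E assume X: "\<forall>n. X n \<in> approx_spectrum I T" and lim: "X \<longlonglongrightarrow> E"
  show "E \<in> approx_spectrum I T"
  proof (rule approx_spectrumI)
    fix c :: real assume c: "c > 0"
    have "\<forall>\<^sub>F n in sequentially. dist (X n) E < c/2"
      using lim c by (intro tendstoD) auto
    then obtain n where n: "\<bar>X n - E\<bar> < c/2"
      by (auto simp: eventually_sequentially dist_real_def)
    obtain i u where iu: "i \<in> I" "u \<noteq> 0" "norm (T i u - X n *\<^sub>R u) \<le> c/2 * norm u"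
      using approx_spectrumD[of "X n" I T "c/2"] X c by auto
    have "T i u - E *\<^sub>R u = (T i u - X n *\<^sub>R u) + (X n - E) *\<^sub>R u"
      by (simp add: algebra_simps)
    then have "norm (T i u - E *\<^sub>R u) \<le> norm (T i u - X n *\<^sub>R u) + \<bar>X n - E\<bar> * norm u"
      by (metis norm_scaleR norm_triangle_ineq)
    also have "\<dots> \<le> c/2 * norm u + c/2 * norm u"
      using iu n by (intro add_mono mult_right_mono) auto
    finally show "\<exists>i\<in>I. \<exists>u. u \<noteq> 0 \<and> norm (T i u - E *\<^sub>R u) \<le> c * norm u"
      using iu by auto
  qed
qed

text \<open>Only a real inner product is assumed, so that finitely supported vectors form an
  admissible space. As \<open>M\<close> does not depend on \<open>i\<close>, the family behaves like
  one bounded symmetric operator on the direct sum.\<close>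

locale symmetric_family =
  fixes I :: "'i set" and T :: "'i \<Rightarrow> 'h \<Rightarrow> 'h::real_inner" and M :: real
  assumes lin: "i \<in> I \<Longrightarrow> linear (T i)"
    and sym: "i \<in> I \<Longrightarrow> T i x \<bullet> y = x \<bullet> T i y"
    and bound: "i \<in> I \<Longrightarrow> norm (T i x) \<le> M * norm x"
begin

lemma approx_spectrum_bounded:
  assumes "E \<in> approx_spectrum I T"
  shows "\<bar>E\<bar> \<le> M"
proof (rule field_le_epsilon)
  fix c :: real assume "c > 0"
  then obtain i u where iu: "i \<in> I" "u \<noteq> 0" "norm (T i u - E *\<^sub>R u) \<le> c * norm u"
    using approx_spectrumD[OF assms] by metis
  have "\<bar>E\<bar> * norm u = norm (T i u - (T i u - E *\<^sub>R u))" by simp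
  also have "\<dots> \<le> norm (T i u) + norm (T i u - E *\<^sub>R u)" by (rule norm_triangle_ineq4)
  also have "\<dots> \<le> (M + c) * norm u" using iu bound[of i u] by (simp add: algebra_simps)
  finally show "\<bar>E\<bar> \<le> M + c" using iu by simp
qed

lemma compact_approx_spectrum: "compact (approx_spectrum I T)"
proof -
  have "approx_spectrum I T \<subseteq> {-M..M}"
    using approx_spectrum_bounded by (auto simp: abs_le_iff minus_le_iff)
  then show ?thesis
    using closed_approx_spectrum bounded_subset[OF bounded_closed_interval] 
    by (auto simp: compact_eq_bounded_closed)
qed

text \<open>Let \<open>c\<close> be the best constant in \<open>c \<parallel>u\<parallel> \<le> \<parallel>S u\<parallel>\<close> for \<open>S = T - E\<close>. The form of
  \<open>P = S\<^sup>2 - c\<^sup>2\<close> is nonnegative, so by the Cauchy--Schwarz inequality \<open>P u\<close> is small for every near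
  minimiser \<open>u\<close>. As \<open>P = (S - c)(S + c)\<close>, one of \<open>E \<plusminus> c\<close> is in the approximate spectrum.\<close>

lemma approx_spectrum_near:
  assumes "i\<^sub>0 \<in> I" "u\<^sub>0 \<noteq> 0" "norm (T i\<^sub>0 u\<^sub>0 - E *\<^sub>R u\<^sub>0) \<le> \<eta> * norm u\<^sub>0"
  shows "\<exists>E'\<in>approx_spectrum I T. \<bar>E' - E\<bar> \<le> \<eta>"
proof -
  define S where "S = (\<lambda>i u. T i u - E *\<^sub>R u)"
  define R where "R = {norm (S i u) / norm u | i u. i \<in> I \<and> u \<noteq> 0}"
  define c where "c = Inf R"
  have R0: "norm (S i\<^sub>0 u\<^sub>0) / norm u\<^sub>0 \<in> R" using assms by (auto simp: R_def)
  have bdd: "bdd_below R" by (rule bdd_belowI[of _ 0]) (auto simp: R_def)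
  have "c \<le> norm (S i\<^sub>0 u\<^sub>0) / norm u\<^sub>0" unfolding c_def using R0 bdd by (rule cInf_lower)
  also have "\<dots> \<le> \<eta>" using assms by (simp add: S_def divide_le_eq)
  finally have c_le: "c \<le> \<eta>" .
  have c0: "0 \<le> c" unfolding c_def using R0 by (intro cInf_greatest) (auto simp: R_def)
  have low: "c * norm u \<le> norm (S i u)" if "i \<in> I" for i u
  proof (cases "u = 0")
    case False
    then have "c \<le> norm (S i u) / norm u"
      unfolding c_def using bdd that by (intro cInf_lower) (auto simp: R_def)
    then show ?thesis using False by (simp add: le_divide_eq)
  qed simp
  have "E + c \<in> approx_spectrum I T \<or> E - c \<in> approx_spectrum I T"
  proof (rule ccontr)
    assume "\<not> ?thesis"
    then obtain k1 k2 where k1: "k1 > 0" "\<And>i u. i \<in> I \<Longrightarrow> k1 * norm u \<le> norm (T i u - (E + c) *\<^sub>R u)"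
      and k2: "k2 > 0" "\<And>i u. i \<in> I \<Longrightarrow> k2 * norm u \<le> norm (T i u - (E - c) *\<^sub>R u)"
      by (metis not_approx_spectrumD)
    define m where "m = \<bar>M\<bar> + \<bar>E\<bar> + 1"
    have m: "m > 0" by (simp add: m_def add_nonneg_pos)
    have up: "norm (S i u) \<le> m * norm u" if "i \<in> I" for i u
    proof -
      have "norm (S i u) \<le> norm (T i u) + \<bar>E\<bar> * norm u"
        unfolding S_def by (metis norm_scaleR norm_triangle_ineq4)
      also have "\<dots> \<le> \<bar>M\<bar> * norm u + \<bar>E\<bar> * norm u"
        using bound[OF that, of u] mult_right_mono[OF abs_ge_self[of M] norm_ge_zero[of u]] by linarith
      also have "\<dots> \<le> m * norm u" by (simp add: m_def algebra_simps)
      finally show ?thesis .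
    qed
    define K where "K = (k1 * k2)\<^sup>2"
    have K: "K > 0" using k1 k2 by (simp add: K_def)
    \<comment> \<open>\<open>e\<close> is the slack by which \<open>u\<close> misses the minimum. It
      is chosen so that \<open>m\<^sup>2 * ((c + e)\<^sup>2 - c\<^sup>2)\<close> is at most
      \<open>K / 2\<close>; the cap 1 turns \<open>2 * c + e\<close> into
      \<open>2 * c + 1\<close>.\<close>
    define e where "e = min 1 (K / (2 * m\<^sup>2 * (2 * c + 1)))"
    have e: "e > 0" "e \<le> 1" "e * (2 * c + 1) * m\<^sup>2 \<le> K / 2"
    proof -
      show "e > 0" "e \<le> 1" using K m c0 by (auto simp: e_def)
      have pos: "(2 * c + 1) * m\<^sup>2 > 0" using m c0 by (simp add: add_nonneg_pos)
      have "e * ((2 * c + 1) * m\<^sup>2) \<le> K / (2 * m\<^sup>2 * (2 * c + 1)) * ((2 * c + 1) * m\<^sup>2)"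
        using pos by (intro mult_right_mono) (auto simp: e_def)
      also have "\<dots> = K / 2" using pos m by (auto simp: field_simps)
      finally show "e * (2 * c + 1) * m\<^sup>2 \<le> K / 2" by (simp add: mult.assoc)
    qed
    have "\<exists>r\<in>R. r < c + e"
      using R0 bdd e(1) unfolding c_def by (subst cInf_less_iff[symmetric]) auto
    then obtain i u where iu: "i \<in> I" "u \<noteq> 0" "norm (S i u) < (c + e) * norm u"
      by (auto simp: R_def divide_less_eq)
    define p where "p = S i (S i u) - c\<^sup>2 *\<^sub>R u"
    have linS: "S i (x - s *\<^sub>R y) = S i x - s *\<^sub>R S i y" for x y s
      using lin[OF iu(1)] by (simp add: S_def linear_diff linear_scale algebra_simps)
    have symS: "S i x \<bullet> y = x \<bullet> S i y" for x y
      using sym[OF iu(1)] by (simp add: S_def inner_diff_left inner_diff_right)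
    have "K * (norm u)\<^sup>2 \<le> (norm p)\<^sup>2"
    proof -
      \<comment> \<open>\<open>y\<close> is (S + c) u and p is (S - c) y, so the lower bounds with
        constants \<open>k2\<close> and \<open>k1\<close> apply in turn.\<close>
      define y where "y = T i u - (E - c) *\<^sub>R u"
      have Ty: "T i y = T i (T i u) - (E - c) *\<^sub>R T i u"
        using lin[OF iu(1)] by (simp add: y_def linear_diff linear_scale)
      have TS: "T i (S i u) = T i (T i u) - E *\<^sub>R T i u"
        using lin[OF iu(1)] by (simp add: S_def linear_diff linear_scale)
      have "p = T i (S i u) - E *\<^sub>R S i u - c\<^sup>2 *\<^sub>R u" by (simp add: p_def S_def)
      also have "\<dots> = T i y - (E + c) *\<^sub>R y"
        unfolding TS Ty by (simp add: S_def y_def algebra_simps power2_eq_square)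
      finally have "p = T i y - (E + c) *\<^sub>R y" .
      then have "k1 * norm y \<le> norm p" using k1(2)[OF iu(1), of y] by simp
      moreover have "k2 * norm u \<le> norm y" using k2(2)[OF iu(1), of u] by (simp add: y_def)
      ultimately have "k1 * (k2 * norm u) \<le> norm p"
        using k1(1) by (meson mult_left_mono less_imp_le order_trans)
      then have "(k1 * (k2 * norm u))\<^sup>2 \<le> (norm p)\<^sup>2"
        using k1(1) k2(1) by (intro power_mono) auto
      then show ?thesis by (simp add: K_def power_mult_distrib algebra_simps)
    qed
    moreover have "(norm p)\<^sup>2 \<le> m\<^sup>2 * ((c + e)\<^sup>2 - c\<^sup>2) * (norm u)\<^sup>2"
    proof -
      \<comment> \<open>Cauchy-Schwarz for the form \<open>f\<close> is obtained by testing its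
        nonnegativity at \<open>u - s *\<^sub>R p\<close>. With \<open>s = 1 / m\<^sup>2\<close> the
        quadratic term is at most half of the linear one.\<close>
      define s where "s = 1 / m\<^sup>2"
      define f where "f = (\<lambda>y. (norm (S i y))\<^sup>2 - c\<^sup>2 * (norm y)\<^sup>2)"
      have sq: "(norm (x - s *\<^sub>R y))\<^sup>2 = (norm x)\<^sup>2 - 2 * s * (x \<bullet> y) + s\<^sup>2 * (norm y)\<^sup>2" for x y :: 'h
        unfolding power2_norm_eq_inner inner_diff_left inner_diff_right
        by (simp add: inner_commute algebra_simps power2_eq_square)
      have "0 \<le> f (u - s *\<^sub>R p)"
        using power_mono[OF low[OF iu(1), of "u - s *\<^sub>R p"], of 2] c0
        by (simp add: f_def power_mult_distrib)
      also have "\<dots> = f u - 2 * s * (S i u \<bullet> S i p - c\<^sup>2 * (u \<bullet> p)) + s\<^sup>2 * f p"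
        by (simp add: f_def linS sq algebra_simps)
      also have "S i u \<bullet> S i p - c\<^sup>2 * (u \<bullet> p) = (norm p)\<^sup>2"
      proof -
        have "S i u \<bullet> S i p - c\<^sup>2 * (u \<bullet> p) = S i (S i u) \<bullet> p - (c\<^sup>2 *\<^sub>R u) \<bullet> p"
          by (simp add: symS)
        also have "\<dots> = p \<bullet> p" by (simp only: inner_diff_left[symmetric] p_def)
        finally show ?thesis by (simp add: power2_norm_eq_inner)
      qed
      finally have "0 \<le> f u - 2 * s * (norm p)\<^sup>2 + s\<^sup>2 * f p" .
      moreover have "s\<^sup>2 * f p \<le> s\<^sup>2 * (m\<^sup>2 * (norm p)\<^sup>2)"
      proof (rule mult_left_mono)
        have "f p \<le> (norm (S i p))\<^sup>2" by (simp add: f_def)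
        also have "\<dots> \<le> (m * norm p)\<^sup>2" using up[OF iu(1)] by (intro power_mono) auto
        finally show "f p \<le> m\<^sup>2 * (norm p)\<^sup>2" by (simp add: power_mult_distrib)
      qed simp
      moreover have "s\<^sup>2 * (m\<^sup>2 * (norm p)\<^sup>2) = s * (norm p)\<^sup>2"
        using m by (simp add: s_def power2_eq_square)
      ultimately have "s * (norm p)\<^sup>2 \<le> f u" by linarith
      also have "f u \<le> ((c + e)\<^sup>2 - c\<^sup>2) * (norm u)\<^sup>2"
        using power_mono[OF less_imp_le[OF iu(3)], of 2]
        unfolding f_def power_mult_distrib left_diff_distrib by simp
      finally have "m\<^sup>2 * (s * (norm p)\<^sup>2) \<le> m\<^sup>2 * (((c + e)\<^sup>2 - c\<^sup>2) * (norm u)\<^sup>2)"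
        by (intro mult_left_mono) auto
      then show ?thesis using m by (simp add: s_def mult.assoc)
    qed
    ultimately have "K * (norm u)\<^sup>2 \<le> (m\<^sup>2 * ((c + e)\<^sup>2 - c\<^sup>2)) * (norm u)\<^sup>2" by linarith
    then have "K \<le> m\<^sup>2 * ((c + e)\<^sup>2 - c\<^sup>2)" using iu(2) by simp
    also have "(c + e)\<^sup>2 - c\<^sup>2 = e * (2 * c + e)" by (simp add: power2_eq_square algebra_simps)
    also have "m\<^sup>2 * (e * (2 * c + e)) \<le> m\<^sup>2 * (e * (2 * c + 1))"
      using e by (intro mult_left_mono) auto
    also have "\<dots> \<le> K / 2" using e(3) by (simp add: algebra_simps)
    finally show False using K by simp
  qed
  then show ?thesis using c0 c_le by (auto intro: bexI[rotated])
qed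

end

subsection \<open>Finitely supported functions on the integers\<close>

text \<open>A type of its own makes finitely supported sequences an instance of
  \<open>real_inner\<close>. The values are complex, but the inner product is the real part of the
  Hermitian one, and symmetry with respect to it is all that the spectral argument uses.\<close>

typedef fsupp = "{u :: int \<Rightarrow> complex. finite {n. u n \<noteq> 0}}"
  morphisms coord Abs_fsupp
  by (rule exI[of _ "\<lambda>_. 0"]) simp

lemma finite_supp: "finite {n. coord u n \<noteq> 0}"
  using coord[of u] by simp

lemma fsupp_eqI: "(\<And>n. coord u n = coord v n) \<Longrightarrow> u = v"
  by (metis coord_inject ext)

lemma coord_Abs: "finite F \<Longrightarrow> (\<And>n. n \<notin> F \<Longrightarrow> f n = 0) \<Longrightarrow> coord (Abs_fsupp f) n = f n"
  by (subst Abs_fsupp_inverse) (auto intro: finite_subset[of _ F])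

instantiation fsupp :: real_inner
begin

definition "(0::fsupp) = Abs_fsupp (\<lambda>_. 0)"
definition "u + v = Abs_fsupp (\<lambda>n. coord u n + coord v n)"
definition "- u = Abs_fsupp (\<lambda>n. - coord u n)"
definition "u - v = Abs_fsupp (\<lambda>n. coord u n - coord v n)"
definition "a *\<^sub>R u = Abs_fsupp (\<lambda>n. a *\<^sub>R coord u n)"
definition "inner u v = (\<Sum>n | coord u n \<noteq> 0. coord u n \<bullet> coord v n)"
definition "norm (u::fsupp) = sqrt (u \<bullet> u)"
definition "sgn (u::fsupp) = inverse (norm u) *\<^sub>R u"
definition "dist (u::fsupp) v = norm (u - v)"
definition [code del]: "(uniformity :: (fsupp \<times> fsupp) filter) = (INF e\<in>{0<..}. principal {(x, y). dist x y < e})"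
definition [code del]: "open (U :: fsupp set) \<longleftrightarrow> (\<forall>x\<in>U. eventually (\<lambda>(x', y). x' = x \<longrightarrow> y \<in> U) uniformity)"

lemma coord_zero: "coord 0 n = 0"
  unfolding zero_fsupp_def by (rule coord_Abs[of "{}"]) auto
lemma coord_add: "coord (u + v) n = coord u n + coord v n"
  unfolding plus_fsupp_def
  by (rule coord_Abs[of "{n. coord u n \<noteq> 0} \<union> {n. coord v n \<noteq> 0}"]) (auto simp: finite_supp)
lemma coord_uminus: "coord (- u) n = - coord u n"
  unfolding uminus_fsupp_def
  by (rule coord_Abs[of "{n. coord u n \<noteq> 0}"]) (auto simp: finite_supp)
lemma coord_diff: "coord (u - v) n = coord u n - coord v n"
  unfolding minus_fsupp_def
  by (rule coord_Abs[of "{n. coord u n \<noteq> 0} \<union> {n. coord v n \<noteq> 0}"]) (auto simp: finite_supp)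
lemma coord_scaleR: "coord (a *\<^sub>R u) n = a *\<^sub>R coord u n"
  unfolding scaleR_fsupp_def
  by (rule coord_Abs[of "{n. coord u n \<noteq> 0}"]) (auto simp: finite_supp)

lemmas coord_ops = coord_zero coord_add coord_uminus coord_diff coord_scaleR

lemma inner_fsupp:
  assumes "finite F" "\<And>n. n \<notin> F \<Longrightarrow> coord u n = 0 \<or> coord v n = 0"
  shows "u \<bullet> v = (\<Sum>n\<in>F. coord u n \<bullet> coord v n)"
proof -
  have "u \<bullet> v = (\<Sum>n\<in>F \<union> {n. coord u n \<noteq> 0}. coord u n \<bullet> coord v n)"
    unfolding inner_fsupp_def using assms by (intro sum.mono_neutral_left) (auto simp: finite_supp)
  also have "\<dots> = (\<Sum>n\<in>F. coord u n \<bullet> coord v n)"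
    using assms by (intro sum.mono_neutral_right) (auto simp: finite_supp, fastforce)
  finally show ?thesis .
qed

instance
proof
  fix x y z :: fsupp and a b :: real
  show "x + y + z = x + (y + z)" "x + y = y + x" "0 + x = x" "- x + x = 0" "x - y = x + - y"
    "a *\<^sub>R (x + y) = a *\<^sub>R x + a *\<^sub>R y" "(a + b) *\<^sub>R x = a *\<^sub>R x + b *\<^sub>R x"
    "a *\<^sub>R b *\<^sub>R x = (a * b) *\<^sub>R x" "1 *\<^sub>R x = x"
    by (auto intro!: fsupp_eqI simp: coord_ops algebra_simps)
  let ?F = "{n. coord x n \<noteq> 0} \<union> {n. coord y n \<noteq> 0} \<union> {n. coord z n \<noteq> 0}"
  have F: "finite ?F" by (simp add: finite_supp)
  show "x \<bullet> y = y \<bullet> x"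
    using inner_fsupp[of ?F x y] inner_fsupp[of ?F y x] F by (simp add: inner_commute)
  show "(x + y) \<bullet> z = x \<bullet> z + y \<bullet> z"
    using inner_fsupp[of ?F x z] inner_fsupp[of ?F y z] inner_fsupp[of ?F "x + y" z] F
    by (simp add: inner_add_left coord_ops sum.distrib)
  show "(a *\<^sub>R x) \<bullet> y = a * (x \<bullet> y)"
    using inner_fsupp[of ?F x y] inner_fsupp[of ?F "a *\<^sub>R x" y] F
    by (simp add: coord_ops sum_distrib_left)
  show "0 \<le> x \<bullet> x" by (simp add: inner_fsupp_def sum_nonneg)
  show "(x \<bullet> x = 0) = (x = 0)"
    by (auto simp: inner_fsupp_def sum_nonneg_eq_0_iff finite_supp coord_ops intro!: fsupp_eqI)
qed (simp_all add: norm_fsupp_def sgn_fsupp_def dist_fsupp_def uniformity_fsupp_def open_fsupp_def)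

end

lemma norm_fsupp:
  assumes "finite F" "\<And>n. n \<notin> F \<Longrightarrow> coord u n = 0"
  shows "(norm u)\<^sup>2 = (\<Sum>n\<in>F. (cmod (coord u n))\<^sup>2)"
  using inner_fsupp[of F u u] assms by (simp add: power2_norm_eq_inner)

lemma sum_le_norm_fsupp:
  assumes "finite F"
  shows "(\<Sum>n\<in>F. (cmod (coord u n))\<^sup>2) \<le> (norm u)\<^sup>2"
proof -
  have "(norm u)\<^sup>2 = (\<Sum>n\<in>F \<union> {n. coord u n \<noteq> 0}. (cmod (coord u n))\<^sup>2)"
    using assms by (intro norm_fsupp) (auto simp: finite_supp)
  also have "\<dots> \<ge> (\<Sum>n\<in>F. (cmod (coord u n))\<^sup>2)"
    using assms by (intro sum_mono2) (auto simp: finite_supp)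
  finally show ?thesis .
qed

lemma fsupp_shift_bound:
  "\<exists>F. finite F \<and> (\<forall>n. n \<notin> F \<longrightarrow> coord u n = 0 \<and> coord u (n - 1) = 0 \<and> coord u (n + 1) = 0)"
proof -
  let ?S = "{n. coord u n \<noteq> 0}"
  have "n \<in> (\<lambda>n. n + 1) ` ?S" if "coord u (n - 1) \<noteq> 0" for n
    using that by (intro image_eqI[of _ _ "n - 1"]) auto
  moreover have "n \<in> (\<lambda>n. n - 1) ` ?S" if "coord u (n + 1) \<noteq> 0" for n
    using that by (intro image_eqI[of _ _ "n + 1"]) auto
  ultimately show ?thesis
    by (intro exI[of _ "?S \<union> (\<lambda>n. n + 1) ` ?S \<union> (\<lambda>n. n - 1) ` ?S"]) (use finite_supp in blast)
qed

subsection \<open>Jacobi matrices\<close>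

lemma sum_shift_le_norm:
  assumes "finite F"
  shows "(\<Sum>n\<in>F. (cmod (coord u (n + k)))\<^sup>2) \<le> (norm u)\<^sup>2"
proof -
  have "(\<Sum>n\<in>F. (cmod (coord u (n + k)))\<^sup>2) = (\<Sum>n\<in>(\<lambda>n. n + k) ` F. (cmod (coord u n))\<^sup>2)"
    by (subst sum.reindex) (auto simp: inj_on_def)
  also have "\<dots> \<le> (norm u)\<^sup>2" using assms by (intro sum_le_norm_fsupp) auto
  finally show ?thesis .
qed

text \<open>Arbitrary coefficient sequences are allowed, so that a change of phase and a change of
  frequency are both instances of a change of coefficients.\<close>

definition jac :: "(int \<Rightarrow> real) \<Rightarrow> (int \<Rightarrow> real) \<Rightarrow> fsupp \<Rightarrow> fsupp" where
  "jac \<beta> \<nu> u = Abs_fsupp (\<lambda>n. of_real (\<beta> (n - 1)) * coord u (n - 1)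
     + of_real (\<beta> n) * coord u (n + 1) + of_real (\<nu> n) * coord u n)"

lemma coord_jac:
  "coord (jac \<beta> \<nu> u) n = of_real (\<beta> (n - 1)) * coord u (n - 1)
     + of_real (\<beta> n) * coord u (n + 1) + of_real (\<nu> n) * coord u n"
proof -
  obtain F where F: "finite F" "\<forall>n. n \<notin> F \<longrightarrow> coord u n = 0 \<and> coord u (n - 1) = 0 \<and> coord u (n + 1) = 0"
    using fsupp_shift_bound[of u] by blast
  show ?thesis unfolding jac_def by (rule coord_Abs[of F]) (use F in auto)
qed

lemma linear_jac: "linear (jac \<beta> \<nu>)"
  by (rule linearI; rule fsupp_eqI) (simp_all add: coord_jac coord_ops algebra_simps scaleR_conv_of_real)

lemma sum_int_shift:
  fixes f :: "int \<Rightarrow> 'a::comm_monoid_add"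
  assumes "finite F" "\<And>n. f n \<noteq> 0 \<Longrightarrow> n \<in> F" "\<And>n. f n \<noteq> 0 \<Longrightarrow> n + 1 \<in> F"
  shows "(\<Sum>n\<in>F. f (n - 1)) = (\<Sum>n\<in>F. f n)"
proof (rule sum.reindex_bij_witness_not_neutral[of "{n\<in>F. f (n - 1) = 0}" "{n\<in>F. f n = 0}" _ "\<lambda>n. n + 1" "\<lambda>n. n - 1"])
qed (use assms in auto)

text \<open>Summation by parts: shifting the index in the hopping terms \<open>p\<close> and
  \<open>r\<close> exchanges the two off-diagonals, which carry the same real coefficient.\<close>

lemma jac_sym: "jac \<beta> \<nu> u \<bullet> w = u \<bullet> jac \<beta> \<nu> w"
proof -
  obtain F where F: "finite F" "\<forall>n. n \<notin> F \<longrightarrow> coord u n = 0 \<and> coord u (n - 1) = 0 \<and> coord u (n + 1) = 0"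
    using fsupp_shift_bound[of u] by blast
  obtain G where G: "finite G" "\<forall>n. n \<notin> G \<longrightarrow> coord w n = 0 \<and> coord w (n - 1) = 0 \<and> coord w (n + 1) = 0"
    using fsupp_shift_bound[of w] by blast
  let ?F = "F \<union> G"
  have fin: "finite ?F" using F G by simp
  have z: "coord u n = 0" "coord w n = 0" if "n \<notin> ?F" for n using F G that by auto
  define p where "p = (\<lambda>n. \<beta> n * (coord u n \<bullet> coord w (n + 1)))"
  define r where "r = (\<lambda>n. \<beta> n * (coord u (n + 1) \<bullet> coord w n))"
  define d where "d = (\<lambda>n. \<nu> n * (coord u n \<bullet> coord w n))"
  have mem: "n \<in> ?F \<and> n + 1 \<in> ?F" if "coord u n \<noteq> 0 \<or> coord w n \<noteq> 0" for n
    using F(2)[rule_format, of n] F(2)[rule_format, of "n + 1"]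
      G(2)[rule_format, of n] G(2)[rule_format, of "n + 1"] that by auto
  have p: "(\<Sum>n\<in>?F. p (n - 1)) = (\<Sum>n\<in>?F. p n)"
  proof (intro sum_int_shift fin)
    fix n assume "p n \<noteq> 0"
    then have "coord u n \<noteq> 0" by (auto simp: p_def)
    then show "n \<in> ?F" "n + 1 \<in> ?F" using mem by blast+
  qed
  have r: "(\<Sum>n\<in>?F. r (n - 1)) = (\<Sum>n\<in>?F. r n)"
  proof (intro sum_int_shift fin)
    fix n assume "r n \<noteq> 0"
    then have "coord w n \<noteq> 0" by (auto simp: r_def)
    then show "n \<in> ?F" "n + 1 \<in> ?F" using mem by blast+
  qed
  have "jac \<beta> \<nu> u \<bullet> w = (\<Sum>n\<in>?F. coord (jac \<beta> \<nu> u) n \<bullet> coord w n)"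
    using z by (intro inner_fsupp fin) auto
  also have "\<dots> = (\<Sum>n\<in>?F. p (n - 1) + r n + d n)"
    by (intro sum.cong refl) (simp add: coord_jac p_def r_def d_def inner_complex_def algebra_simps)
  also have "\<dots> = (\<Sum>n\<in>?F. r (n - 1) + p n + d n)"
    using p r by (simp add: sum.distrib)
  also have "\<dots> = (\<Sum>n\<in>?F. coord u n \<bullet> coord (jac \<beta> \<nu> w) n)"
    by (intro sum.cong refl) (simp add: coord_jac p_def r_def d_def inner_complex_def algebra_simps)
  also have "\<dots> = u \<bullet> jac \<beta> \<nu> w"
    using z by (intro inner_fsupp[symmetric] fin) auto
  finally show ?thesis .
qed

lemma sum3_square_le: "(x + y + z)\<^sup>2 \<le> 3 * (x\<^sup>2 + y\<^sup>2 + z\<^sup>2)" for x y z :: real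
proof -
  have "3 * (x\<^sup>2 + y\<^sup>2 + z\<^sup>2) - (x + y + z)\<^sup>2 = (x - y)\<^sup>2 + (y - z)\<^sup>2 + (x - z)\<^sup>2"
    by (simp add: power2_eq_square algebra_simps)
  then show ?thesis by (metis diff_ge_0_iff_ge sum_power2_ge_zero add_nonneg_nonneg zero_le_power2)
qed

text \<open>The square of the constant is 9 D^2: one factor 3 from \<open>sum3_square_le\<close>,
  another from the three shifted copies of \<open>u\<close>.\<close>

lemma norm_le_neighbours:
  assumes "\<And>n. cmod (coord w n) \<le> D * (cmod (coord u (n - 1)) + cmod (coord u (n + 1)) + cmod (coord u n))"
    and "D \<ge> 0"
  shows "norm w \<le> 3 * D * norm u"
proof -
  let ?F = "{n. coord w n \<noteq> 0}"
  have "(norm w)\<^sup>2 = (\<Sum>n\<in>?F. (cmod (coord w n))\<^sup>2)"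
    by (intro norm_fsupp) (auto simp: finite_supp)
  also have "\<dots> \<le> (\<Sum>n\<in>?F. 3 * D\<^sup>2 * ((cmod (coord u (n + (-1))))\<^sup>2 + (cmod (coord u (n + 1)))\<^sup>2 + (cmod (coord u (n + 0)))\<^sup>2))"
  proof (intro sum_mono)
    fix n
    have "(cmod (coord w n))\<^sup>2 \<le> (D * (cmod (coord u (n - 1)) + cmod (coord u (n + 1)) + cmod (coord u n)))\<^sup>2"
      using assms by (intro power_mono) auto
    also have "\<dots> \<le> D\<^sup>2 * (3 * ((cmod (coord u (n - 1)))\<^sup>2 + (cmod (coord u (n + 1)))\<^sup>2 + (cmod (coord u n))\<^sup>2))"
      unfolding power_mult_distrib by (intro mult_left_mono sum3_square_le) auto
    finally show "(cmod (coord w n))\<^sup>2 \<le> 3 * D\<^sup>2 * ((cmod (coord u (n + (-1))))\<^sup>2 + (cmod (coord u (n + 1)))\<^sup>2 + (cmod (coord u (n + 0)))\<^sup>2)"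
      by (simp add: algebra_simps)
  qed
  also have "\<dots> = 3 * D\<^sup>2 * ((\<Sum>n\<in>?F. (cmod (coord u (n + (-1))))\<^sup>2) + (\<Sum>n\<in>?F. (cmod (coord u (n + 1)))\<^sup>2) + (\<Sum>n\<in>?F. (cmod (coord u (n + 0)))\<^sup>2))"
    by (simp only: sum_distrib_left[symmetric] sum.distrib)
  also have "\<dots> \<le> 3 * D\<^sup>2 * ((norm u)\<^sup>2 + (norm u)\<^sup>2 + (norm u)\<^sup>2)"
    by (intro mult_left_mono add_mono sum_shift_le_norm finite_supp) auto
  also have "\<dots> = (3 * D * norm u)\<^sup>2" by (simp add: power2_eq_square)
  finally show ?thesis by (rule power2_le_imp_le) (use assms in auto)
qed

text \<open>Closeness of the coefficients is required only at sites and bonds that \<open>u\<close>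
  touches. This is what makes short support valuable: orbits with different frequencies drift apart,
  but stay close on a short window.\<close>

lemma jac_diff_norm:
  assumes \<beta>: "\<And>n. coord u n \<noteq> 0 \<or> coord u (n + 1) \<noteq> 0 \<Longrightarrow> \<bar>\<beta> n - \<beta>' n\<bar> \<le> D"
    and \<nu>: "\<And>n. coord u n \<noteq> 0 \<Longrightarrow> \<bar>\<nu> n - \<nu>' n\<bar> \<le> D" and D: "D \<ge> 0"
  shows "norm (jac \<beta> \<nu> u - jac \<beta>' \<nu>' u) \<le> 3 * D * norm u"
proof (rule norm_le_neighbours)
  fix n
  have "coord (jac \<beta> \<nu> u - jac \<beta>' \<nu>' u) n = of_real (\<beta> (n - 1) - \<beta>' (n - 1)) * coord u (n - 1)
     + of_real (\<beta> n - \<beta>' n) * coord u (n + 1) + of_real (\<nu> n - \<nu>' n) * coord u n"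
    by (simp add: coord_jac coord_ops algebra_simps)
  also have "cmod \<dots> \<le> cmod (of_real (\<beta> (n - 1) - \<beta>' (n - 1)) * coord u (n - 1))
     + cmod (of_real (\<beta> n - \<beta>' n) * coord u (n + 1)) + cmod (of_real (\<nu> n - \<nu>' n) * coord u n)"
    by (intro norm_triangle_le add_mono order_refl)
  also have "\<dots> = \<bar>\<beta> (n - 1) - \<beta>' (n - 1)\<bar> * cmod (coord u (n - 1))
     + \<bar>\<beta> n - \<beta>' n\<bar> * cmod (coord u (n + 1)) + \<bar>\<nu> n - \<nu>' n\<bar> * cmod (coord u n)"
    by (simp only: norm_mult norm_of_real)
  also have "\<dots> \<le> D * cmod (coord u (n - 1)) + D * cmod (coord u (n + 1)) + D * cmod (coord u n)"
  proof (intro add_mono)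
    show "\<bar>\<beta> (n - 1) - \<beta>' (n - 1)\<bar> * cmod (coord u (n - 1)) \<le> D * cmod (coord u (n - 1))"
      using \<beta>[of "n - 1"] by (cases "coord u (n - 1) = 0") (auto intro!: mult_right_mono)
    show "\<bar>\<beta> n - \<beta>' n\<bar> * cmod (coord u (n + 1)) \<le> D * cmod (coord u (n + 1))"
      using \<beta>[of n] by (cases "coord u (n + 1) = 0") (auto intro!: mult_right_mono)
    show "\<bar>\<nu> n - \<nu>' n\<bar> * cmod (coord u n) \<le> D * cmod (coord u n)"
      using \<nu>[of n] by (cases "coord u n = 0") (auto intro!: mult_right_mono)
  qed
  finally show "cmod (coord (jac \<beta> \<nu> u - jac \<beta>' \<nu>' u) n)
      \<le> D * (cmod (coord u (n - 1)) + cmod (coord u (n + 1)) + cmod (coord u n))"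
    by (simp add: algebra_simps)
qed (fact D)

lemma jac_bound:
  assumes "\<And>n. \<bar>\<beta> n\<bar> \<le> B" "\<And>n. \<bar>\<nu> n\<bar> \<le> B"
  shows "norm (jac \<beta> \<nu> u) \<le> 3 * B * norm u"
proof -
  have "jac (\<lambda>_. 0) (\<lambda>_. 0) u = 0" by (rule fsupp_eqI) (simp add: coord_jac coord_ops)
  then show ?thesis
    using jac_diff_norm[of u \<beta> "\<lambda>_. 0" B \<nu> "\<lambda>_. 0"] assms order_trans[OF abs_ge_zero assms(1)] by auto
qed

lemma periodic_of_int:
  fixes f :: "real \<Rightarrow> real"
  assumes "\<And>x. f (x + 1) = f x"
  shows "f (x + of_int k) = f x"
proof -
  have nat: "f (x + of_nat n) = f x" for n x
    by (induction n arbitrary: x) (simp_all add: assms add.assoc[symmetric])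
  show ?thesis
    using nat[of x "nat k"] nat[of "x + of_int k" "nat (- k)"] by (cases "k \<ge> 0") auto
qed

section \<open>The operators with coefficients sampled along an orbit\<close>

locale quasiperiodic =
  fixes b v :: "real \<Rightarrow> real" and B \<Lambda> :: real
  assumes b_per: "b (x + 1) = b x" and v_per: "v (x + 1) = v x"
    and b_bdd: "\<bar>b x\<bar> \<le> B" and v_bdd: "\<bar>v x\<bar> \<le> B"
    and b_lip: "\<bar>b x - b y\<bar> \<le> \<Lambda> * \<bar>x - y\<bar>" and v_lip: "\<bar>v x - v y\<bar> \<le> \<Lambda> * \<bar>x - y\<bar>"
begin

definition H :: "real \<Rightarrow> real \<Rightarrow> fsupp \<Rightarrow> fsupp" where
  "H \<alpha> \<theta> = jac (\<lambda>n. b (\<theta> + of_int n * \<alpha>)) (\<lambda>n. v (\<theta> + of_int n * \<alpha>))"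

lemma symmetric_H: "symmetric_family I (H \<alpha>) (3 * B)"
  by (rule symmetric_family.intro) (simp_all add: H_def linear_jac jac_sym jac_bound b_bdd v_bdd)

lemma b_per_int: "b (x + of_int k) = b x" and v_per_int: "v (x + of_int k) = v x"
  using periodic_of_int b_per v_per by blast+

text \<open>The direct sum has phases in \<open>{0..<1}\<close> only. This lets the phase range over
  all reals in \<open>approx_spectrum UNIV\<close>, where it can be shifted freely.\<close>

lemma H_frac: "H \<alpha> (frac \<theta>) = H \<alpha> \<theta>"
proof -
  have "frac \<theta> + of_int n * \<alpha> = (\<theta> + of_int n * \<alpha>) + of_int (- \<lfloor>\<theta>\<rfloor>)" for n
    by (simp add: frac_def)
  then show ?thesis unfolding H_def by (simp only: b_per_int v_per_int)
qed

end

subsection \<open>The spectrum of the direct sum\<close>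

text \<open>Membership and norm bounds are both tested on finite sets, where \<open>L2_set\<close>
  has a triangle inequality.\<close>

lemma ell2I:
  assumes "\<And>x. x \<notin> A \<Longrightarrow> \<phi> x = 0" "0 \<le> K"
    and "\<And>F. finite F \<Longrightarrow> F \<subseteq> A \<Longrightarrow> L2_set (\<lambda>x. cmod (\<phi> x)) F \<le> K"
  shows "\<phi> \<in> ell2 A" "ell2_norm A \<phi> \<le> K"
proof -
  have le: "(\<Sum>x\<in>F. (cmod (\<phi> x))\<^sup>2) \<le> K\<^sup>2" if "finite F" "F \<subseteq> A" for F
    using assms(3)[OF that] assms(2) by (auto simp: L2_set_def dest: real_le_rsqrt sqrt_le_D)
  have sm: "(\<lambda>x. (cmod (\<phi> x))\<^sup>2) summable_on A"
    by (intro nonneg_bdd_above_summable_on bdd_aboveI[of _ "K\<^sup>2"]) (auto simp: le)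
  then show "\<phi> \<in> ell2 A" using assms(1) by (auto simp: ell2_def)
  have "infsum (\<lambda>x. (cmod (\<phi> x))\<^sup>2) A \<le> K\<^sup>2"
    using sm le by (rule infsum_le_finite_sums)
  then show "ell2_norm A \<phi> \<le> K"
    unfolding ell2_norm_def using assms(2) by (rule real_le_lsqrt[rotated])
qed

lemma ell2D:
  assumes "\<phi> \<in> ell2 A" "finite F" "F \<subseteq> A"
  shows "L2_set (\<lambda>x. cmod (\<phi> x)) F \<le> ell2_norm A \<phi>"
  unfolding L2_set_def ell2_norm_def
  using assms by (intro real_sqrt_le_mono finite_sum_le_infsum) (auto simp: ell2_def)

lemma ell2_norm_nonneg [simp]: "0 \<le> ell2_norm A \<phi>"
  by (simp add: ell2_norm_def infsum_nonneg)

lemma ell2_outside: "\<phi> \<in> ell2 A \<Longrightarrow> x \<notin> A \<Longrightarrow> \<phi> x = 0"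
  by (simp add: ell2_def)

lemma cmod_le_ell2_norm:
  assumes "\<phi> \<in> ell2 A"
  shows "cmod (\<phi> x) \<le> ell2_norm A \<phi>"
proof (cases "x \<in> A")
  case True
  then show ?thesis using ell2D[OF assms, of "{x}"] by simp
qed (simp add: ell2_outside[OF assms])

lemma ell2_lincomb:
  assumes "\<phi> \<in> ell2 A" "\<psi> \<in> ell2 A"
  shows "(\<lambda>x. \<phi> x + c * \<psi> x) \<in> ell2 A"
    "ell2_norm A (\<lambda>x. \<phi> x + c * \<psi> x) \<le> ell2_norm A \<phi> + cmod c * ell2_norm A \<psi>"
proof -
  have "L2_set (\<lambda>x. cmod (\<phi> x + c * \<psi> x)) F \<le> ell2_norm A \<phi> + cmod c * ell2_norm A \<psi>"
    if F: "finite F" "F \<subseteq> A" for F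
  proof -
    have "L2_set (\<lambda>x. cmod (\<phi> x + c * \<psi> x)) F \<le> L2_set (\<lambda>x. cmod (\<phi> x) + cmod c * cmod (\<psi> x)) F"
      by (intro L2_set_mono) (auto simp: norm_mult[symmetric] norm_triangle_ineq)
    also have "\<dots> \<le> L2_set (\<lambda>x. cmod (\<phi> x)) F + L2_set (\<lambda>x. cmod c * cmod (\<psi> x)) F"
      by (rule L2_set_triangle_ineq)
    also have "\<dots> \<le> ell2_norm A \<phi> + cmod c * ell2_norm A \<psi>"
      using ell2D[OF assms(1) F] ell2D[OF assms(2) F]
      by (simp add: L2_set_right_distrib[symmetric] add_mono mult_left_mono)
    finally show ?thesis .
  qed
  then show "(\<lambda>x. \<phi> x + c * \<psi> x) \<in> ell2 A"
    "ell2_norm A (\<lambda>x. \<phi> x + c * \<psi> x) \<le> ell2_norm A \<phi> + cmod c * ell2_norm A \<psi>"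
    using ell2I[of A "\<lambda>x. \<phi> x + c * \<psi> x" "ell2_norm A \<phi> + cmod c * ell2_norm A \<psi>"] assms
    by (simp_all add: ell2_outside)
qed

lemma ell2_diff: "\<phi> \<in> ell2 A \<Longrightarrow> \<psi> \<in> ell2 A \<Longrightarrow> (\<lambda>x. \<phi> x - \<psi> x) \<in> ell2 A"
  using ell2_lincomb(1)[of \<phi> A \<psi> "-1"] by simp

text \<open>Quantitative form of the fact that a symmetric operator bounded below is invertible: S^2
  lies between c^2 and M^2, so 1 - S^2/M^2 is a strict contraction when c > 0, and S^2 can be
  inverted by a Neumann series.\<close>

lemma symmetric_contraction:
  fixes S :: "'h \<Rightarrow> 'h::real_inner"
  assumes "\<And>x y. S x \<bullet> y = x \<bullet> S y" "\<And>x. norm (S x) \<le> M * norm x" "\<And>x. c * norm x \<le> norm (S x)"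
    and "0 \<le> c" "c \<le> M" "0 < M"
  shows "norm (x - (1 / M\<^sup>2) *\<^sub>R S (S x)) \<le> sqrt (1 - c\<^sup>2 / M\<^sup>2) * norm x"
proof -
  define t where "t = 1 / M\<^sup>2"
  have t: "t > 0" "t * M\<^sup>2 = 1" using assms by (auto simp: t_def)
  have "(norm (x - t *\<^sub>R S (S x)))\<^sup>2 = (norm x)\<^sup>2 - 2 * t * (x \<bullet> S (S x)) + t\<^sup>2 * (norm (S (S x)))\<^sup>2"
    unfolding power2_norm_eq_inner inner_diff_left inner_diff_right
    by (simp add: inner_commute algebra_simps power2_eq_square)
  also have "x \<bullet> S (S x) = (norm (S x))\<^sup>2"
    by (simp add: assms(1)[symmetric] power2_norm_eq_inner)
  also have "t\<^sup>2 * (norm (S (S x)))\<^sup>2 \<le> t\<^sup>2 * (M * norm (S x))\<^sup>2"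
    using assms(2)[of "S x"] by (intro mult_left_mono power_mono) auto
  also have "t\<^sup>2 * (M * norm (S x))\<^sup>2 = t * (norm (S x))\<^sup>2"
    using t(2) by (simp add: power2_eq_square)
  finally have "(norm (x - t *\<^sub>R S (S x)))\<^sup>2 \<le> (norm x)\<^sup>2 - t * (norm (S x))\<^sup>2" by simp
  also have "\<dots> \<le> (norm x)\<^sup>2 - t * (c * norm x)\<^sup>2"
    using assms(3)[of x] assms(4) t by (intro diff_left_mono mult_left_mono power_mono) auto
  also have "\<dots> = (1 - c\<^sup>2 / M\<^sup>2) * (norm x)\<^sup>2"
    by (simp add: t_def power_mult_distrib algebra_simps)
  finally have "sqrt ((norm (x - t *\<^sub>R S (S x)))\<^sup>2) \<le> sqrt ((1 - c\<^sup>2 / M\<^sup>2) * (norm x)\<^sup>2)"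
    by (rule real_sqrt_le_mono)
  then show ?thesis by (simp add: real_sqrt_mult t_def)
qed

text \<open>Carries an operator bound from finitely supported vectors in the fibres over to the
  whole space. By \<open>local\<close> a value at \<open>n\<close> depends only on sites within
  distance 2, so on a finite set of indices \<open>\<phi>\<close> may be truncated to
  \<open>u\<close> with a margin of 2. Two is the reach of a Jacobi matrix applied twice.\<close>

lemma fibrewise_bound:
  fixes R :: "(real \<times> int \<Rightarrow> complex) \<Rightarrow> real \<times> int \<Rightarrow> complex" and R\<^sub>0 :: "real \<Rightarrow> fsupp \<Rightarrow> fsupp"
  assumes local: "\<And>\<theta> n u. \<theta> \<in> {0..<1} \<Longrightarrow> (\<And>m. \<bar>m - n\<bar> \<le> 2 \<Longrightarrow> coord u m = \<phi> (\<theta>, m)) \<Longrightarrow> R \<phi> (\<theta>, n) = coord (R\<^sub>0 \<theta> u) n"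
    and outside: "\<And>x. x \<notin> jacobi_index \<Longrightarrow> R \<phi> x = 0"
    and R\<^sub>0: "\<And>\<theta> u. norm (R\<^sub>0 \<theta> u) \<le> \<rho> * norm u" and \<rho>: "\<rho> \<ge> 0"
    and \<phi>: "\<phi> \<in> ell2 jacobi_index"
  shows "R \<phi> \<in> ell2 jacobi_index" "ell2_norm jacobi_index (R \<phi>) \<le> \<rho> * ell2_norm jacobi_index \<phi>"
proof -
  have *: "L2_set (\<lambda>x. cmod (R \<phi> x)) F \<le> \<rho> * ell2_norm jacobi_index \<phi>"
    if F: "finite F" "F \<subseteq> jacobi_index" for F
  proof -
    let ?\<Theta> = "fst ` F"
    obtain N where N: "snd ` F \<subseteq> {-N..N}"
    proof -
      have "finite (abs ` snd ` F)" using F by simp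
      then obtain N where "\<forall>n\<in>abs ` snd ` F. n \<le> N"
        using Max_ge by blast
      then have "snd ` F \<subseteq> {-N..N}" by (force simp: abs_le_iff)
      then show thesis ..
    qed
    define u where "u = (\<lambda>\<theta>. Abs_fsupp (\<lambda>m. if m \<in> {-N-2..N+2} then \<phi> (\<theta>, m) else 0))"
    have u: "coord (u \<theta>) m = (if m \<in> {-N-2..N+2} then \<phi> (\<theta>, m) else 0)" for \<theta> m
      unfolding u_def by (rule coord_Abs[of "{-N-2..N+2}"]) auto
    have \<Theta>: "?\<Theta> \<subseteq> {0..<1}" using F(2) by (auto simp: jacobi_index_def)
    have R: "R \<phi> (\<theta>, n) = coord (R\<^sub>0 \<theta> (u \<theta>)) n" if "\<theta> \<in> ?\<Theta>" "n \<in> {-N..N}" for \<theta> n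
      using that \<Theta> by (intro local) (auto simp: u abs_le_iff)
    have "(\<Sum>x\<in>F. (cmod (R \<phi> x))\<^sup>2) \<le> (\<Sum>x\<in>?\<Theta> \<times> {-N..N}. (cmod (R \<phi> x))\<^sup>2)"
      using F N by (intro sum_mono2) (auto simp: image_subset_iff, force+)
    also have "\<dots> = (\<Sum>\<theta>\<in>?\<Theta>. \<Sum>n\<in>{-N..N}. (cmod (R \<phi> (\<theta>, n)))\<^sup>2)"
      by (simp add: sum.cartesian_product)
    also have "\<dots> = (\<Sum>\<theta>\<in>?\<Theta>. \<Sum>n\<in>{-N..N}. (cmod (coord (R\<^sub>0 \<theta> (u \<theta>)) n))\<^sup>2)"
      by (intro sum.cong refl) (simp add: R)
    also have "\<dots> \<le> (\<Sum>\<theta>\<in>?\<Theta>. (\<rho> * norm (u \<theta>))\<^sup>2)"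
    proof (intro sum_mono)
      fix \<theta>
      have "(\<Sum>n\<in>{-N..N}. (cmod (coord (R\<^sub>0 \<theta> (u \<theta>)) n))\<^sup>2) \<le> (norm (R\<^sub>0 \<theta> (u \<theta>)))\<^sup>2"
        by (rule sum_le_norm_fsupp) simp
      also have "\<dots> \<le> (\<rho> * norm (u \<theta>))\<^sup>2" using R\<^sub>0 by (intro power_mono) auto
      finally show "(\<Sum>n\<in>{-N..N}. (cmod (coord (R\<^sub>0 \<theta> (u \<theta>)) n))\<^sup>2) \<le> (\<rho> * norm (u \<theta>))\<^sup>2" .
    qed
    also have "\<dots> = (\<Sum>\<theta>\<in>?\<Theta>. \<rho>\<^sup>2 * (\<Sum>n\<in>{-N-2..N+2}. (cmod (\<phi> (\<theta>, n)))\<^sup>2))"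
    proof (intro sum.cong refl)
      fix \<theta>
      have "(norm (u \<theta>))\<^sup>2 = (\<Sum>n\<in>{-N-2..N+2}. (cmod (coord (u \<theta>) n))\<^sup>2)"
        by (rule norm_fsupp) (auto simp: u)
      also have "\<dots> = (\<Sum>n\<in>{-N-2..N+2}. (cmod (\<phi> (\<theta>, n)))\<^sup>2)"
        by (intro sum.cong refl) (simp add: u)
      finally show "(\<rho> * norm (u \<theta>))\<^sup>2 = \<rho>\<^sup>2 * (\<Sum>n\<in>{-N-2..N+2}. (cmod (\<phi> (\<theta>, n)))\<^sup>2)"
        by (simp add: power_mult_distrib)
    qed
    also have "\<dots> = \<rho>\<^sup>2 * (\<Sum>x\<in>?\<Theta> \<times> {-N-2..N+2}. (cmod (\<phi> x))\<^sup>2)"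
      by (simp add: sum_distrib_left sum.cartesian_product case_prod_unfold)
    finally have "L2_set (\<lambda>x. cmod (R \<phi> x)) F \<le> sqrt (\<rho>\<^sup>2 * (\<Sum>x\<in>?\<Theta> \<times> {-N-2..N+2}. (cmod (\<phi> x))\<^sup>2))"
      unfolding L2_set_def by (rule real_sqrt_le_mono)
    also have "\<dots> = \<rho> * L2_set (\<lambda>x. cmod (\<phi> x)) (?\<Theta> \<times> {-N-2..N+2})"
      using \<rho> by (simp add: real_sqrt_mult L2_set_def)
    also have "\<dots> \<le> \<rho> * ell2_norm jacobi_index \<phi>"
      using \<rho> \<phi> F \<Theta> by (intro mult_left_mono ell2D) (auto simp: jacobi_index_def)
    finally show ?thesis .
  qed
  show "R \<phi> \<in> ell2 jacobi_index" "ell2_norm jacobi_index (R \<phi>) \<le> \<rho> * ell2_norm jacobi_index \<phi>"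
    using ell2I[of jacobi_index "R \<phi>" "\<rho> * ell2_norm jacobi_index \<phi>"] outside * \<rho> by auto
qed

section \<open>Agreement of the Hilbert space spectrum with the approximate spectrum\<close>

context quasiperiodic
begin

lemma B_nonneg: "B \<ge> 0"
  using order_trans[OF abs_ge_zero b_bdd] .

text \<open>A uniform lower bound for S = H - E makes K = 1 - t S^2 a contraction on the whole
  space. The Neumann series for t S^2 \<phi> = \<psi> gives the preimage t S \<phi> of \<psi> under
  S, and the contraction also gives the resolvent bound.\<close>

lemma spectrum_subset: "jacobi_sum_spectrum v b \<alpha> \<subseteq> approx_spectrum UNIV (H \<alpha>)"
proof
  fix E assume E: "E \<in> jacobi_sum_spectrum v b \<alpha>"
  show "E \<in> approx_spectrum UNIV (H \<alpha>)"
  proof (rule ccontr)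
    assume "E \<notin> approx_spectrum UNIV (H \<alpha>)"
    then obtain c\<^sub>0 where c\<^sub>0: "c\<^sub>0 > 0" "\<And>\<theta> u. c\<^sub>0 * norm u \<le> norm (H \<alpha> \<theta> u - E *\<^sub>R u)"
      using not_approx_spectrumD[of E UNIV "H \<alpha>"] by auto
    interpret symmetric_family UNIV "H \<alpha>" "3 * B" by (rule symmetric_H)
    define M where "M = 3 * B + \<bar>E\<bar> + 1"
    \<comment> \<open>The cap at \<open>M\<close> keeps the radicand in \<open>\<rho>\<close>
      nonnegative.\<close>
    define c where "c = min c\<^sub>0 M"
    define \<rho> where "\<rho> = sqrt (1 - c\<^sup>2 / M\<^sup>2)"
    define t where "t = 1 / M\<^sup>2"
    define S where "S = (\<lambda>\<theta> u. H \<alpha> \<theta> u - E *\<^sub>R u)"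
    define Sg where "Sg = (\<lambda>\<phi> x. jacobi_sum v b \<alpha> \<phi> x - complex_of_real E * \<phi> x)"
    define K where "K = (\<lambda>\<phi> x. \<phi> x - complex_of_real t * Sg (Sg \<phi>) x)"
    let ?A = jacobi_index
    let ?N = "ell2_norm jacobi_index"
    have M: "M > 0" using B_nonneg by (simp add: M_def)
    have c: "c > 0" "c \<le> M" using c\<^sub>0 M by (auto simp: c_def)
    have t: "t > 0" using M by (simp add: t_def)
    have "c\<^sup>2 \<le> M\<^sup>2" using c by (intro power_mono) auto
    then have \<rho>: "0 \<le> \<rho>" "\<rho> < 1" using c M by (auto simp: \<rho>_def)
    have symS: "S \<theta> x \<bullet> y = x \<bullet> S \<theta> y" for \<theta> x y
      by (simp add: S_def inner_diff_left inner_diff_right sym)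
    have upS: "norm (S \<theta> x) \<le> M * norm x" for \<theta> x
    proof -
      have "norm (S \<theta> x) \<le> norm (H \<alpha> \<theta> x) + norm (E *\<^sub>R x)"
        unfolding S_def by (rule norm_triangle_ineq4)
      also have "\<dots> \<le> M * norm x" using bound[of \<theta> x] norm_ge_zero[of x]
        by (simp add: M_def algebra_simps del: norm_ge_zero)
      finally show ?thesis .
    qed
    have lowS: "c * norm x \<le> norm (S \<theta> x)" for \<theta> x
    proof -
      have "c * norm x \<le> c\<^sub>0 * norm x" by (intro mult_right_mono) (auto simp: c_def)
      then show ?thesis using c\<^sub>0(2)[of x \<theta>] by (simp add: S_def)
    qed
    have contr: "norm (x - t *\<^sub>R S \<theta> (S \<theta> x)) \<le> \<rho> * norm x" for \<theta> x
      unfolding t_def \<rho>_def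
      by (rule symmetric_contraction) (use symS upS lowS c M in auto)
    have local: "Sg \<phi> (\<theta>, n) = coord (S \<theta> u) n"
      if "\<theta> \<in> {0..<1}" "\<And>m. \<bar>m - n\<bar> \<le> 1 \<Longrightarrow> coord u m = \<phi> (\<theta>, m)" for \<phi> \<theta> n u
      using that(2)[of n] that(2)[of "n - 1"] that(2)[of "n + 1"] that(1)
      by (simp add: Sg_def S_def jacobi_sum_def jacobi_def H_def coord_jac coord_ops scaleR_conv_of_real)
    have outside: "Sg \<phi> x = 0" if "\<phi> \<in> ell2 ?A" "x \<notin> ?A" for \<phi> x
      using that ell2_outside[OF that]
      by (cases x) (auto simp: Sg_def jacobi_sum_def jacobi_index_def)
    have Sg: "Sg \<phi> \<in> ell2 ?A" "?N (Sg \<phi>) \<le> M * ?N \<phi>" if "\<phi> \<in> ell2 ?A" for \<phi>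
    proof -
      note * = fibrewise_bound[of \<phi> Sg S M, OF _ outside[OF that] upS less_imp_le[OF M] that]
      show "Sg \<phi> \<in> ell2 ?A" by (rule *(1)) (rule local, simp_all)
      show "?N (Sg \<phi>) \<le> M * ?N \<phi>" by (rule *(2)) (rule local, simp_all)
    qed
    have K: "K \<phi> \<in> ell2 ?A" "?N (K \<phi>) \<le> \<rho> * ?N \<phi>" if "\<phi> \<in> ell2 ?A" for \<phi>
    proof -
      have K_local: "K \<phi> (\<theta>, n) = coord (u - t *\<^sub>R S \<theta> (S \<theta> u)) n"
        if "\<theta> \<in> {0..<1}" "\<And>m. \<bar>m - n\<bar> \<le> 2 \<Longrightarrow> coord u m = \<phi> (\<theta>, m)" for \<theta> n u
      proof -
        have "coord (S \<theta> u) m = Sg \<phi> (\<theta>, m)" if "\<bar>m - n\<bar> \<le> 1" for m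
          using that \<open>\<theta> \<in> {0..<1}\<close> \<open>\<And>m. \<bar>m - n\<bar> \<le> 2 \<Longrightarrow> coord u m = \<phi> (\<theta>, m)\<close>
          by (intro local[symmetric]) auto
        then have "Sg (Sg \<phi>) (\<theta>, n) = coord (S \<theta> (S \<theta> u)) n"
          using that(1) by (intro local) auto
        then show ?thesis using that(2)[of n]
          by (simp add: K_def coord_ops scaleR_conv_of_real)
      qed
      have K_outside: "K \<phi> x = 0" if "x \<notin> ?A" for x
        using ell2_outside[OF \<open>\<phi> \<in> ell2 ?A\<close> that] outside[OF Sg(1)[OF \<open>\<phi> \<in> ell2 ?A\<close>] that]
        by (simp add: K_def)
      note * = fibrewise_bound[of \<phi> K "\<lambda>\<theta> u. u - t *\<^sub>R S \<theta> (S \<theta> u)" \<rho>, OF _ K_outside contr \<rho>(1) that]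
      show "K \<phi> \<in> ell2 ?A" by (rule *(1)) (rule K_local)
      show "?N (K \<phi>) \<le> \<rho> * ?N \<phi>" by (rule *(2)) (rule K_local)
    qed
    \<comment> \<open>Read off from \<phi> = K \<phi> + t S (S \<phi>): the first term has norm at
      most \<open>\<rho>\<close> times that of \<open>\<phi>\<close> and is absorbed on the
      left.\<close>
    have lower: "?N \<phi> \<le> t * M / (1 - \<rho>) * ?N (Sg \<phi>)" if "\<phi> \<in> ell2 ?A" for \<phi>
    proof -
      have "?N \<phi> = ?N (\<lambda>x. K \<phi> x + complex_of_real t * Sg (Sg \<phi>) x)" by (simp add: K_def)
      also have "\<dots> \<le> ?N (K \<phi>) + cmod (complex_of_real t) * ?N (Sg (Sg \<phi>))"
        using that by (intro ell2_lincomb K Sg)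
      also have "\<dots> \<le> \<rho> * ?N \<phi> + t * (M * ?N (Sg \<phi>))"
        using t K[OF that] Sg(2)[OF Sg(1)[OF that]] by (intro add_mono) (auto intro!: mult_left_mono)
      finally show ?thesis using \<rho> by (simp add: field_simps)
    qed
    have Sg_diff: "Sg (\<lambda>x. \<phi> x - \<psi> x) = (\<lambda>x. Sg \<phi> x - Sg \<psi> x)" for \<phi> \<psi>
      by (auto simp: Sg_def jacobi_sum_def jacobi_def algebra_simps fun_eq_iff)
    have inj: "inj_on Sg (ell2 ?A)"
    proof (rule inj_onI)
      fix \<phi> \<psi> assume *: "\<phi> \<in> ell2 ?A" "\<psi> \<in> ell2 ?A" "Sg \<phi> = Sg \<psi>"
      let ?d = "\<lambda>x. \<phi> x - \<psi> x"
      have d: "?d \<in> ell2 ?A" using * by (intro ell2_diff)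
      have "Sg ?d = (\<lambda>x. 0)" using *(3) by (simp add: Sg_diff)
      then have "?N ?d \<le> 0" using lower[OF d] by (simp add: ell2_norm_def)
      then have "cmod (?d x) \<le> 0" for x using cmod_le_ell2_norm[OF d, of x] by linarith
      then show "\<phi> = \<psi>" by (auto simp: fun_eq_iff)
    qed
    have surj: "\<exists>\<phi>\<in>ell2 ?A. Sg \<phi> = \<psi>" if \<psi>: "\<psi> \<in> ell2 ?A" for \<psi>
    proof -
      \<comment> \<open>The terms of the Neumann series for (1 - K) \<phi> = \<psi>. They are summed
        pointwise, and the bound on finite sets passes to the limit and places the sum in
        \<open>ell2 ?A\<close>.\<close>
      define y where "y = (\<lambda>k. (K ^^ k) \<psi>)"
      have y: "y k \<in> ell2 ?A" "?N (y k) \<le> \<rho> ^ k * ?N \<psi>" for k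
      proof (induction k)
        case 0
        { case 1 show ?case using \<psi> by (simp add: y_def) }
        { case 2 show ?case by (simp add: y_def) }
      next
        case (Suc k)
        { case 1 show ?case using K(1)[OF Suc(1)] by (simp add: y_def) }
        { case 2
          have "?N (y (Suc k)) \<le> \<rho> * ?N (y k)" using K(2)[OF Suc(1)] by (simp add: y_def)
          also have "\<dots> \<le> \<rho> * (\<rho> ^ k * ?N \<psi>)" using \<rho> Suc(2) by (intro mult_left_mono)
          finally show ?case by (simp add: mult.assoc) }
      qed
      have geo: "summable (\<lambda>k. \<rho> ^ k * ?N \<psi>)" "(\<Sum>k. \<rho> ^ k * ?N \<psi>) = ?N \<psi> / (1 - \<rho>)"
        using \<rho> by (auto intro!: summable_mult2 simp: suminf_mult2[symmetric] suminf_geometric)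
      define \<phi> where "\<phi> = (\<lambda>x. \<Sum>k. y k x)"
      have sums: "(\<lambda>k. y k x) sums \<phi> x" for x
      proof -
        have "summable (\<lambda>k. y k x)"
          by (rule summable_comparison_test'[OF geo(1), of 0])
             (rule order_trans[OF cmod_le_ell2_norm[OF y(1)] y(2)])
        then show ?thesis by (simp add: \<phi>_def summable_sums)
      qed
      have \<phi>: "\<phi> \<in> ell2 ?A"
      proof (rule ell2I)
        show "\<phi> x = 0" if "x \<notin> ?A" for x
          using ell2_outside[OF y(1) that] by (simp add: \<phi>_def)
        show "0 \<le> ?N \<psi> / (1 - \<rho>)" using \<rho> by simp
        fix F assume F: "finite F" "F \<subseteq> ?A"
        have part: "L2_set (\<lambda>x. cmod (\<Sum>k<n. y k x)) F \<le> (\<Sum>k<n. \<rho> ^ k * ?N \<psi>)" for n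
        proof (induction n)
          case 0
          show ?case by (simp add: L2_set_0')
        next
          case (Suc n)
          have "L2_set (\<lambda>x. cmod (\<Sum>k<Suc n. y k x)) F
              \<le> L2_set (\<lambda>x. cmod (\<Sum>k<n. y k x) + cmod (y n x)) F"
            by (intro L2_set_mono) (auto simp: norm_triangle_ineq)
          also have "\<dots> \<le> L2_set (\<lambda>x. cmod (\<Sum>k<n. y k x)) F + L2_set (\<lambda>x. cmod (y n x)) F"
            by (rule L2_set_triangle_ineq)
          also have "\<dots> \<le> (\<Sum>k<n. \<rho> ^ k * ?N \<psi>) + \<rho> ^ n * ?N \<psi>"
            using Suc ell2D[OF y(1) F, of n] y(2)[of n] by (intro add_mono) auto
          finally show ?case by simp
        qed
        have "(\<lambda>n. L2_set (\<lambda>x. cmod (\<Sum>k<n. y k x)) F) \<longlonglongrightarrow> L2_set (\<lambda>x. cmod (\<phi> x)) F"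
          unfolding L2_set_def using sums by (intro tendsto_intros) (simp add: sums_def)
        moreover have "L2_set (\<lambda>x. cmod (\<Sum>k<n. y k x)) F \<le> ?N \<psi> / (1 - \<rho>)" for n
          unfolding geo(2)[symmetric] using \<rho>
          by (intro order_trans[OF part[of n]] sum_le_suminf geo(1)) auto
        ultimately show "L2_set (\<lambda>x. cmod (\<phi> x)) F \<le> ?N \<psi> / (1 - \<rho>)"
          by (intro LIMSEQ_le_const2) auto
      qed
      \<comment> \<open>Each value of \<open>Sg\<close> involves finitely many coordinates, so
        \<open>Sg\<close> commutes with pointwise convergent series.\<close>
      have Sg_sums: "(\<lambda>k. Sg (z k) x) sums Sg w x" if "\<And>x. (\<lambda>k. z k x) sums w x" for z w x
      proof (cases x)
        case (Pair \<theta> n)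
        show ?thesis
          unfolding Sg_def jacobi_sum_def jacobi_def Pair prod.case
          by (cases "\<theta> \<in> {0..<1}") (simp_all only: if_True if_False, (intro sums_add sums_diff sums_mult that sums_zero)+)
      qed
      have "(\<lambda>k. K (y k) x) sums K \<phi> x" for x
        unfolding K_def by (intro sums_diff sums_mult Sg_sums sums)
      moreover have "K (y k) = y (Suc k)" for k by (simp add: y_def)
      ultimately have "(\<lambda>k. y (Suc k) x) sums K \<phi> x" for x by simp
      moreover have "(\<lambda>k. y (Suc k) x) sums (\<phi> x - y 0 x)" for x
        using sums[of x] sums_Suc_iff[of "\<lambda>k. y k x" "\<phi> x - y 0 x"] by simp
      ultimately have "K \<phi> x = \<phi> x - \<psi> x" for x
        using sums_unique2[of "\<lambda>k. y (Suc k) x" "K \<phi> x" "\<phi> x - y 0 x"] by (simp add: y_def)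
      then have eq: "complex_of_real t * Sg (Sg \<phi>) x = \<psi> x" for x by (simp add: K_def)
      \<comment> \<open>The preimage of \<open>\<psi>\<close>; the summand 0 puts it into the form
        of \<open>ell2_lincomb\<close>.\<close>
      let ?\<phi> = "\<lambda>x. 0 + complex_of_real t * Sg \<phi> x"
      have "Sg ?\<phi> x = complex_of_real t * Sg (Sg \<phi>) x" for x
        unfolding Sg_def jacobi_sum_def jacobi_def by (cases x) (simp add: algebra_simps)
      then have "Sg ?\<phi> = \<psi>" using eq by (auto simp: fun_eq_iff)
      moreover have "(\<lambda>x. 0) \<in> ell2 ?A" by (simp add: ell2_def)
      then have "?\<phi> \<in> ell2 ?A" using Sg(1)[OF \<phi>] by (rule ell2_lincomb)
      ultimately show ?thesis by blast
    qed
    have "bij_betw Sg (ell2 ?A) (ell2 ?A)"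
      using inj surj Sg(1) by (auto simp: bij_betw_def)
    with lower have "complex_of_real E \<notin> ell2_spectrum ?A (jacobi_sum v b \<alpha>)"
      unfolding ell2_spectrum_def mem_Collect_eq not_not Sg_def by (intro conjI exI ballI)
    then show False using E by (simp add: jacobi_sum_spectrum_def)
  qed
qed

text \<open>A finitely supported approximate eigenvector of one fibre, extended by zero to the other
  fibres, violates any proposed resolvent bound \<open>C\<close>.\<close>

lemma spectrum_superset: "approx_spectrum UNIV (H \<alpha>) \<subseteq> jacobi_sum_spectrum v b \<alpha>"
proof
  fix E assume E: "E \<in> approx_spectrum UNIV (H \<alpha>)"
  let ?A = jacobi_index
  let ?Sg = "\<lambda>\<phi> x. jacobi_sum v b \<alpha> \<phi> x - complex_of_real E * \<phi> x"
  have False if C: "\<forall>\<phi>\<in>ell2 ?A. ell2_norm ?A \<phi> \<le> C * ell2_norm ?A (?Sg \<phi>)" for C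
  proof -
    \<comment> \<open>This makes \<open>max C 1 * c = 1/2\<close>; the maximum covers a constant
      \<open>C\<close> that is zero or negative.\<close>
    define c where "c = 1 / (2 * max C 1)"
    have "c > 0" by (simp add: c_def)
    then obtain \<theta>' u where u: "u \<noteq> 0" "norm (H \<alpha> \<theta>' u - E *\<^sub>R u) \<le> c * norm u"
      using approx_spectrumD[OF E] by metis
    define \<theta> where "\<theta> = frac \<theta>'"
    have \<theta>: "\<theta> \<in> {0..<1}" by (simp add: \<theta>_def frac_lt_1)
    define em where "em = (\<lambda>w (\<theta>'', n). if \<theta>'' = \<theta> then coord w n else 0)"
    have em: "em w \<in> ell2 ?A" "ell2_norm ?A (em w) = norm w" for w
    proof -
      let ?S = "{n. coord w n \<noteq> 0}"
      have "(\<lambda>x. (cmod (em w x))\<^sup>2) summable_on (Pair \<theta> ` ?S)"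
        by (intro summable_on_finite) (simp add: finite_supp)
      also have "?this \<longleftrightarrow> (\<lambda>x. (cmod (em w x))\<^sup>2) summable_on ?A"
        using \<theta> by (intro summable_on_cong_neutral) (auto simp: em_def jacobi_index_def split: if_splits)
      finally show "em w \<in> ell2 ?A"
        using \<theta> by (auto simp: ell2_def em_def jacobi_index_def)
      have "infsum (\<lambda>x. (cmod (em w x))\<^sup>2) ?A = infsum (\<lambda>x. (cmod (em w x))\<^sup>2) (Pair \<theta> ` ?S)"
        using \<theta> by (intro infsum_cong_neutral) (auto simp: em_def jacobi_index_def split: if_splits)
      also have "\<dots> = (\<Sum>n\<in>?S. (cmod (em w (\<theta>, n)))\<^sup>2)"
        by (subst infsum_finite) (auto simp: finite_supp sum.reindex inj_on_def)
      also have "\<dots> = (norm w)\<^sup>2"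
        by (subst norm_fsupp[of ?S]) (auto simp: finite_supp em_def)
      finally show "ell2_norm ?A (em w) = norm w" by (simp add: ell2_norm_def)
    qed
    have "?Sg (em u) = em (H \<alpha> \<theta> u - E *\<^sub>R u)"
    proof (rule ext, clarify)
      fix \<theta>'' n
      show "?Sg (em u) (\<theta>'', n) = em (H \<alpha> \<theta> u - E *\<^sub>R u) (\<theta>'', n)"
        using \<theta> by (simp add: em_def jacobi_sum_def jacobi_def H_def coord_jac coord_ops scaleR_conv_of_real)
    qed
    then have "norm u \<le> C * norm (H \<alpha> \<theta> u - E *\<^sub>R u)"
      using C[rule_format, OF em(1)[of u]] em(2) by simp
    also have "\<dots> \<le> max C 1 * norm (H \<alpha> \<theta> u - E *\<^sub>R u)" by (intro mult_right_mono) auto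
    also have "\<dots> \<le> max C 1 * (c * norm u)"
      using u(2) by (intro mult_left_mono) (auto simp: \<theta>_def H_frac)
    also have "\<dots> = norm u / 2" by (simp add: c_def)
    finally show False using u(1) by simp
  qed
  then show "E \<in> jacobi_sum_spectrum v b \<alpha>"
    by (auto simp: jacobi_sum_spectrum_def ell2_spectrum_def)
qed

lemma spectrum_eq: "jacobi_sum_spectrum v b \<alpha> = approx_spectrum UNIV (H \<alpha>)"
  using spectrum_subset spectrum_superset by (rule equalityI)

end

subsection \<open>Localisation\<close>

text \<open>The hat function whose integer translates form a partition of unity. Its squares are
  used, as in an IMS localisation formula: they sum to between 1/2 and 2 at every point.\<close>

definition tent :: "real \<Rightarrow> real" where
  "tent x = max 0 (1 - \<bar>x\<bar>)"

lemma tent_ge_half: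
  assumes "finite J" "\<lfloor>x\<rfloor> \<in> J" "\<lfloor>x\<rfloor> + 1 \<in> J"
  shows "1/2 \<le> (\<Sum>j\<in>J. (tent (x - of_int j))\<^sup>2)"
proof -
  have f: "x - of_int \<lfloor>x\<rfloor> = frac x" "0 \<le> frac x" "frac x < 1"
    by (simp_all add: frac_lt_1 frac_ge_0) (simp add: frac_def)
  have "1/2 \<le> (1 - frac x)\<^sup>2 + (frac x)\<^sup>2"
    using zero_le_power2[of "2 * frac x - 1"] by (simp add: power2_eq_square algebra_simps)
  also have "\<dots> = (\<Sum>j\<in>{\<lfloor>x\<rfloor>, \<lfloor>x\<rfloor> + 1}. (tent (x - of_int j))\<^sup>2)"
    using f by (simp add: tent_def)
  also have "\<dots> \<le> (\<Sum>j\<in>J. (tent (x - of_int j))\<^sup>2)"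
    using assms by (intro sum_mono2) auto
  finally show ?thesis .
qed

lemma sum_tent_le:
  assumes "finite J"
  shows "(\<Sum>j\<in>J. (tent (x - of_int j))\<^sup>2) \<le> 2"
proof -
  have "(\<Sum>j\<in>J. (tent (x - of_int j))\<^sup>2) \<le> (\<Sum>j\<in>J \<union> {\<lfloor>x\<rfloor>, \<lfloor>x\<rfloor> + 1}. (tent (x - of_int j))\<^sup>2)"
    using assms by (intro sum_mono2) auto
  also have "\<dots> = (\<Sum>j\<in>{\<lfloor>x\<rfloor>, \<lfloor>x\<rfloor> + 1}. (tent (x - of_int j))\<^sup>2)"
  proof (rule sum.mono_neutral_right)
    show "\<forall>j\<in>J \<union> {\<lfloor>x\<rfloor>, \<lfloor>x\<rfloor> + 1} - {\<lfloor>x\<rfloor>, \<lfloor>x\<rfloor> + 1}. (tent (x - of_int j))\<^sup>2 = 0"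
      unfolding tent_def max_def by (auto simp: abs_if split: if_splits) linarith+
  qed (use assms in auto)
  also have "\<dots> \<le> (\<Sum>j\<in>{\<lfloor>x\<rfloor>, \<lfloor>x\<rfloor> + 1}. 1)"
    by (intro sum_mono) (auto simp: tent_def power_le_one)
  finally show ?thesis by simp
qed

text \<open>Each translate is 1-Lipschitz, and since \<open>x\<close> and \<open>y\<close> are at
  distance at most 1, only the four translates centred in \<open>?D\<close> can be nonzero at either
  point.\<close>

lemma sum_tent_diff_le:
  assumes "finite J" "\<bar>x - y\<bar> \<le> 1"
  shows "(\<Sum>j\<in>J. (tent (y - of_int j) - tent (x - of_int j))\<^sup>2) \<le> 4 * (x - y)\<^sup>2"
proof -
  let ?D = "{\<lfloor>x\<rfloor> - 1..\<lfloor>x\<rfloor> + 2}"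
  have "(\<Sum>j\<in>J. (tent (y - of_int j) - tent (x - of_int j))\<^sup>2)
      \<le> (\<Sum>j\<in>J \<union> ?D. (tent (y - of_int j) - tent (x - of_int j))\<^sup>2)"
    using assms by (intro sum_mono2) auto
  also have "\<dots> = (\<Sum>j\<in>?D. (tent (y - of_int j) - tent (x - of_int j))\<^sup>2)"
  proof (rule sum.mono_neutral_right)
    show "\<forall>j\<in>J \<union> ?D - ?D. (tent (y - of_int j) - tent (x - of_int j))\<^sup>2 = 0"
    proof
      fix j assume "j \<in> J \<union> ?D - ?D"
      then have "j \<le> \<lfloor>x\<rfloor> - 2 \<or> j \<ge> \<lfloor>x\<rfloor> + 3" by auto
      then have "tent (x - of_int j) = 0 \<and> tent (y - of_int j) = 0"
        using assms(2) unfolding tent_def by linarith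
      then show "(tent (y - of_int j) - tent (x - of_int j))\<^sup>2 = 0" by simp
    qed
  qed (use assms in auto)
  also have "\<dots> \<le> (\<Sum>j\<in>?D. (x - y)\<^sup>2)"
  proof (intro sum_mono)
    fix j :: int
    have "\<bar>tent (y - of_int j) - tent (x - of_int j)\<bar> \<le> \<bar>x - y\<bar>" unfolding tent_def by linarith
    then show "(tent (y - of_int j) - tent (x - of_int j))\<^sup>2 \<le> (x - y)\<^sup>2" by (simp add: abs_le_square_iff)
  qed
  finally show ?thesis by simp
qed

context quasiperiodic
begin

text \<open>Cut-offs that vary at speed \<open>1 / (W |b|)\<close> commute with \<open>H\<close> up to \<open>O(1/W)\<close>, so they may be
  as short as the window in which \<open>1 / |b|\<close> sums to \<open>W\<close>. The phase \<open>\<theta>'\<close> is chosen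
  such that both orbits agree at a point of the window.\<close>

lemma localisation:
  assumes \<kappa>: "\<kappa> > 0" and W: "1 / \<kappa> \<le> W"
    and window: "\<And>\<theta>. W \<le> (\<Sum>k<L. 1 / max \<bar>b (\<theta> + of_nat k * \<alpha>)\<bar> \<kappa>)"
    and E: "E \<in> approx_spectrum UNIV (H \<alpha>)"
  shows "\<exists>E'\<in>approx_spectrum UNIV (H \<alpha>'). \<bar>E' - E\<bar> \<le> 8 / W + 9 * \<Lambda> * of_nat L * \<bar>\<alpha> - \<alpha>'\<bar>"
proof -
  have W0: "W > 0" using \<kappa> W by (smt (verit) divide_pos_pos)
  have L: "L > 0" using window[of 0] W0 by (cases L) auto
  have \<Lambda>: "\<Lambda> \<ge> 0" using b_lip[of 1 0] by simp
  obtain \<theta> u where u: "u \<noteq> 0" "norm (H \<alpha> \<theta> u - E *\<^sub>R u) \<le> 1 / W * norm u"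
    using approx_spectrumD[OF E, of "1 / W"] W0 by (metis divide_pos_pos zero_less_one)
  define \<beta> where "\<beta> = (\<lambda>n. b (\<theta> + of_int n * \<alpha>))"
  define S where "S = (\<lambda>u. H \<alpha> \<theta> u - E *\<^sub>R u)"
  \<comment> \<open>The weight measures length so that cut-offs of unit slope in
    \<open>X / W\<close> have slope about 1/(W |b|) in \<open>n\<close>. Since
    \<open>1 / \<kappa> \<le> W\<close>, one site advances \<open>X / W\<close> by at most 1, as
    \<open>sum_tent_diff_le\<close> demands.\<close>
  define w where "w = (\<lambda>n. 1 / max \<bar>\<beta> n\<bar> \<kappa>)"
  let ?U = "{n. coord u n \<noteq> 0}"
  obtain N where N: "\<And>n. coord u n \<noteq> 0 \<Longrightarrow> N \<le> n"
  proof
    fix n assume "coord u n \<noteq> 0"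
    then show "Min ?U \<le> n" by (simp add: finite_supp)
  qed
  define X where "X = (\<lambda>n. \<Sum>k\<in>{N..<n}. w k)"
  have w: "0 < w n" "w n \<le> W" "\<bar>\<beta> n\<bar> * w n \<le> 1" for n
  proof -
    have mx: "max \<bar>\<beta> n\<bar> \<kappa> > 0" "\<bar>\<beta> n\<bar> \<le> max \<bar>\<beta> n\<bar> \<kappa>" "\<kappa> \<le> max \<bar>\<beta> n\<bar> \<kappa>" using \<kappa> by auto
    then show "0 < w n" "\<bar>\<beta> n\<bar> * w n \<le> 1" by (auto simp: w_def divide_le_eq)
    have "w n \<le> 1 / \<kappa>" unfolding w_def using mx \<kappa> by (intro divide_left_mono) auto
    then show "w n \<le> W" using W by simp
  qed
  have X_step: "\<bar>X (n + 1) - X n\<bar> \<le> w n" for n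
  proof (cases "N \<le> n")
    case True
    then have "{N..<n + 1} = insert n {N..<n}" by auto
    then show ?thesis using w(1)[of n] by (simp add: X_def)
  qed (use w(1)[of n] in \<open>simp add: X_def\<close>)
  have X_mono: "X n \<le> X m" if "n \<le> m" for n m
    unfolding X_def using that w(1) by (intro sum_mono2) (auto intro: less_imp_le)
  have X_window: "X (n + int L) \<ge> X n + W" if "N \<le> n" for n
  proof -
    have "{N..<n + int L} = {N..<n} \<union> {n..<n + int L}" using that by auto
    then have "X (n + int L) = X n + (\<Sum>k\<in>{n..<n + int L}. w k)"
      unfolding X_def by (simp only:, subst sum.union_disjoint) auto
    also have "(\<Sum>k\<in>{n..<n + int L}. w k) = (\<Sum>k<L. w (n + int k))"
      by (rule sum.reindex_bij_witness[of _ "\<lambda>k. n + int k" "\<lambda>k. nat (k - n)"]) auto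
    also have "\<dots> = (\<Sum>k<L. 1 / max \<bar>b ((\<theta> + of_int n * \<alpha>) + of_nat k * \<alpha>)\<bar> \<kappa>)"
      by (simp add: w_def \<beta>_def algebra_simps)
    finally show ?thesis using window[of "\<theta> + of_int n * \<alpha>"] by simp
  qed
  define f where "f = (\<lambda>j n. tent (X n / W - of_int j))"
  define J where "J = (\<Union>n\<in>?U. {\<lfloor>X n / W\<rfloor>, \<lfloor>X n / W\<rfloor> + 1})"
  have J: "finite J" by (simp add: J_def finite_supp)
  define g where "g = (\<lambda>j. Abs_fsupp (\<lambda>n. of_real (f j n) * coord u n))"
  have g: "coord (g j) n = of_real (f j n) * coord u n" for j n
    unfolding g_def by (rule coord_Abs[of ?U]) (auto simp: finite_supp)
  have mass: "(norm u)\<^sup>2 / 2 \<le> (\<Sum>j\<in>J. (norm (g j))\<^sup>2)"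
  proof -
    have "(norm u)\<^sup>2 / 2 = (\<Sum>n\<in>?U. (cmod (coord u n))\<^sup>2 * (1/2))"
      by (subst norm_fsupp[of ?U]) (auto simp: finite_supp sum_divide_distrib)
    also have "\<dots> \<le> (\<Sum>n\<in>?U. (cmod (coord u n))\<^sup>2 * (\<Sum>j\<in>J. (f j n)\<^sup>2))"
      unfolding f_def by (intro sum_mono mult_left_mono tent_ge_half J) (auto simp: J_def)
    also have "\<dots> = (\<Sum>j\<in>J. \<Sum>n\<in>?U. (cmod (coord (g j) n))\<^sup>2)"
      by (subst sum.swap) (simp add: sum_distrib_left g norm_mult power_mult_distrib mult_ac)
    also have "\<dots> = (\<Sum>j\<in>J. (norm (g j))\<^sup>2)"
      by (intro sum.cong refl norm_fsupp[symmetric]) (auto simp: finite_supp g)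
    finally show ?thesis .
  qed
  \<comment> \<open>30 = 6 + 12 + 12: the factor 3 of \<open>sum3_square_le\<close> times 2 from
    \<open>sum_tent_le\<close>, and times 4 from \<open>sum_tent_diff_le\<close> for each of the two
    commutator terms.\<close>
  have err: "(\<Sum>j\<in>J. (norm (S (g j)))\<^sup>2) \<le> 30 / W\<^sup>2 * (norm u)\<^sup>2"
  proof -
    define F where "F = (\<Union>j\<in>J. {n. coord (S (g j)) n \<noteq> 0})"
    have F: "finite F" using J by (simp add: F_def finite_supp)
    \<comment> \<open>Up to sign, the off-diagonal entries of the commutator of \<open>S\<close>
      with multiplication by \<open>f j\<close>. The factor \<open>\<bar>\<beta> n\<bar>\<close>
      cancels against the slope \<open>w n / W\<close>.\<close>
    define d where "d = (\<lambda>j n. \<beta> n * (f j (n + 1) - f j n))"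
    have d: "(\<Sum>j\<in>J. (d j n)\<^sup>2) \<le> 4 / W\<^sup>2" for n
    proof -
      have x1: "\<bar>X (n + 1) / W - X n / W\<bar> \<le> w n / W"
        using X_step[of n] W0 by (simp add: diff_divide_distrib[symmetric] divide_right_mono)
      also have "\<dots> \<le> 1" using w(2)[of n] W0 by simp
      finally have x2: "\<bar>X n / W - X (n + 1) / W\<bar> \<le> 1" by (simp add: abs_minus_commute)
      have "(\<Sum>j\<in>J. (d j n)\<^sup>2) = (\<beta> n)\<^sup>2 * (\<Sum>j\<in>J. (f j (n + 1) - f j n)\<^sup>2)"
        by (simp add: d_def power_mult_distrib sum_distrib_left)
      also have "\<dots> \<le> (\<beta> n)\<^sup>2 * (4 * (X n / W - X (n + 1) / W)\<^sup>2)"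
        unfolding f_def using x2 by (intro mult_left_mono sum_tent_diff_le J) auto
      also have "\<dots> \<le> (\<beta> n)\<^sup>2 * (4 * (w n / W)\<^sup>2)"
      proof -
        have "\<bar>X n / W - X (n + 1) / W\<bar> \<le> \<bar>w n / W\<bar>" using x1 by linarith
        then have "(X n / W - X (n + 1) / W)\<^sup>2 \<le> (w n / W)\<^sup>2" by (simp only: abs_le_square_iff)
        then show ?thesis by (intro mult_left_mono) auto
      qed
      also have "\<dots> = 4 * (\<bar>\<beta> n\<bar> * w n)\<^sup>2 / W\<^sup>2" by (simp add: power_mult_distrib power_divide)
      also have "\<dots> \<le> 4 * 1\<^sup>2 / W\<^sup>2"
        using w(3)[of n] w(1)[of n] by (intro divide_right_mono mult_left_mono power_mono) auto
      finally show ?thesis by simp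
    qed
    have pt: "(\<Sum>j\<in>J. (cmod (coord (S (g j)) n))\<^sup>2) \<le>
        6 * (cmod (coord (S u) (n + 0)))\<^sup>2 + 12 / W\<^sup>2 * (cmod (coord u (n + (-1))))\<^sup>2
        + 12 / W\<^sup>2 * (cmod (coord u (n + 1)))\<^sup>2" for n
    proof -
      have 1: "(cmod (coord (S (g j)) n))\<^sup>2 \<le> 3 * ((f j n)\<^sup>2 * (cmod (coord (S u) n))\<^sup>2
         + (d j (n - 1))\<^sup>2 * (cmod (coord u (n - 1)))\<^sup>2 + (d j n)\<^sup>2 * (cmod (coord u (n + 1)))\<^sup>2)" for j
      proof -
        have "coord (S (g j)) n = of_real (f j n) * coord (S u) n
            - of_real (d j (n - 1)) * coord u (n - 1) + of_real (d j n) * coord u (n + 1)"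
          by (simp add: S_def H_def coord_jac coord_ops g d_def \<beta>_def scaleR_conv_of_real algebra_simps)
        also have "cmod \<dots> \<le> cmod (of_real (f j n) * coord (S u) n)
            + cmod (of_real (d j (n - 1)) * coord u (n - 1)) + cmod (of_real (d j n) * coord u (n + 1))"
          by (intro order_trans[OF norm_triangle_ineq] add_mono norm_triangle_ineq4 order_refl)
        also have "\<dots> = \<bar>f j n\<bar> * cmod (coord (S u) n)
            + \<bar>d j (n - 1)\<bar> * cmod (coord u (n - 1)) + \<bar>d j n\<bar> * cmod (coord u (n + 1))"
          by (simp only: norm_mult norm_of_real)
        finally have "(cmod (coord (S (g j)) n))\<^sup>2 \<le> (\<bar>f j n\<bar> * cmod (coord (S u) n)
            + \<bar>d j (n - 1)\<bar> * cmod (coord u (n - 1)) + \<bar>d j n\<bar> * cmod (coord u (n + 1)))\<^sup>2"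
          by (intro power_mono) auto
        also have "\<dots> \<le> 3 * ((\<bar>f j n\<bar> * cmod (coord (S u) n))\<^sup>2
            + (\<bar>d j (n - 1)\<bar> * cmod (coord u (n - 1)))\<^sup>2 + (\<bar>d j n\<bar> * cmod (coord u (n + 1)))\<^sup>2)"
          by (rule sum3_square_le)
        finally show ?thesis by (simp add: power_mult_distrib)
      qed
      have "(\<Sum>j\<in>J. (cmod (coord (S (g j)) n))\<^sup>2) \<le> (\<Sum>j\<in>J. 3 * ((f j n)\<^sup>2 * (cmod (coord (S u) n))\<^sup>2
         + (d j (n - 1))\<^sup>2 * (cmod (coord u (n - 1)))\<^sup>2 + (d j n)\<^sup>2 * (cmod (coord u (n + 1)))\<^sup>2))"
        by (intro sum_mono 1)
      also have "\<dots> = 3 * ((\<Sum>j\<in>J. (f j n)\<^sup>2) * (cmod (coord (S u) n))\<^sup>2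
         + (\<Sum>j\<in>J. (d j (n - 1))\<^sup>2) * (cmod (coord u (n - 1)))\<^sup>2 + (\<Sum>j\<in>J. (d j n)\<^sup>2) * (cmod (coord u (n + 1)))\<^sup>2)"
        by (simp only: sum_distrib_left[symmetric] sum.distrib sum_distrib_right[symmetric])
      also have "\<dots> \<le> 3 * (2 * (cmod (coord (S u) n))\<^sup>2
         + 4 / W\<^sup>2 * (cmod (coord u (n - 1)))\<^sup>2 + 4 / W\<^sup>2 * (cmod (coord u (n + 1)))\<^sup>2)"
        unfolding f_def by (intro mult_left_mono add_mono mult_right_mono d sum_tent_le J) auto
      finally show ?thesis by simp
    qed
    have "(\<Sum>j\<in>J. (norm (S (g j)))\<^sup>2) = (\<Sum>j\<in>J. \<Sum>n\<in>F. (cmod (coord (S (g j)) n))\<^sup>2)"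
      using F by (intro sum.cong refl norm_fsupp) (auto simp: F_def)
    also have "\<dots> = (\<Sum>n\<in>F. \<Sum>j\<in>J. (cmod (coord (S (g j)) n))\<^sup>2)" by (rule sum.swap)
    also have "\<dots> \<le> (\<Sum>n\<in>F. 6 * (cmod (coord (S u) (n + 0)))\<^sup>2 + 12 / W\<^sup>2 * (cmod (coord u (n + (-1))))\<^sup>2
        + 12 / W\<^sup>2 * (cmod (coord u (n + 1)))\<^sup>2)"
      by (intro sum_mono pt)
    also have "\<dots> = 6 * (\<Sum>n\<in>F. (cmod (coord (S u) (n + 0)))\<^sup>2) + 12 / W\<^sup>2 * (\<Sum>n\<in>F. (cmod (coord u (n + (-1))))\<^sup>2)
        + 12 / W\<^sup>2 * (\<Sum>n\<in>F. (cmod (coord u (n + 1)))\<^sup>2)"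
      by (simp only: sum.distrib sum_distrib_left)
    also have "\<dots> \<le> 6 * (norm (S u))\<^sup>2 + 12 / W\<^sup>2 * (norm u)\<^sup>2 + 12 / W\<^sup>2 * (norm u)\<^sup>2"
      by (intro add_mono mult_left_mono sum_shift_le_norm F) auto
    also have "\<dots> \<le> 6 * (1 / W * norm u)\<^sup>2 + 12 / W\<^sup>2 * (norm u)\<^sup>2 + 12 / W\<^sup>2 * (norm u)\<^sup>2"
      using u(2) by (intro add_mono mult_left_mono power_mono order_refl) (auto simp: S_def)
    finally show ?thesis by (simp add: power_mult_distrib power_divide algebra_simps)
  qed
  \<comment> \<open>Averaging: if every \<open>j\<close> failed, \<open>mass\<close> and
    \<open>err\<close> would give 64/2 \<le> 30. The root of 64 is the 8 in the conclusion.\<close>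
  have "\<exists>j\<in>J. (norm (S (g j)))\<^sup>2 < 64 / W\<^sup>2 * (norm (g j))\<^sup>2"
  proof (rule ccontr)
    assume "\<not> ?thesis"
    then have "(\<Sum>j\<in>J. 64 / W\<^sup>2 * (norm (g j))\<^sup>2) \<le> (\<Sum>j\<in>J. (norm (S (g j)))\<^sup>2)"
      by (intro sum_mono) (auto simp: not_less)
    then have "64 / W\<^sup>2 * (\<Sum>j\<in>J. (norm (g j))\<^sup>2) \<le> 30 / W\<^sup>2 * (norm u)\<^sup>2"
      unfolding sum_distrib_left using err by (rule order_trans)
    moreover have "64 / W\<^sup>2 * ((norm u)\<^sup>2 / 2) \<le> 64 / W\<^sup>2 * (\<Sum>j\<in>J. (norm (g j))\<^sup>2)"
      by (intro mult_left_mono mass) auto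
    ultimately have "64 / W\<^sup>2 * ((norm u)\<^sup>2 / 2) \<le> 30 / W\<^sup>2 * (norm u)\<^sup>2" by linarith
    then show False using W0 u(1) by (simp add: field_simps)
  qed
  then obtain j where j: "(norm (S (g j)))\<^sup>2 < 64 / W\<^sup>2 * (norm (g j))\<^sup>2" by blast
  then have g0: "g j \<noteq> 0" by auto
  have Sg: "norm (S (g j)) \<le> 8 / W * norm (g j)"
  proof (rule power2_le_imp_le)
    show "(norm (S (g j)))\<^sup>2 \<le> (8 / W * norm (g j))\<^sup>2"
      using j by (simp add: power_mult_distrib power_divide)
  qed (use W0 in auto)
  obtain n\<^sub>0 where n\<^sub>0: "coord (g j) n\<^sub>0 \<noteq> 0"
    using g0 by (metis fsupp_eqI coord_zero)
  \<comment> \<open>On the support of \<open>f j\<close> the value of \<open>X\<close> varies by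
    less than 2 W, while every \<open>L\<close> sites increase it by at least
    \<open>W\<close>.\<close>
  have supp: "\<bar>n - m\<bar> < 2 * int L" if "coord (g j) n \<noteq> 0" "coord (g j) m \<noteq> 0" for n m
  proof -
    have aux: "n - m < 2 * int L" if nm: "coord (g j) n \<noteq> 0" "coord (g j) m \<noteq> 0" for n m
    proof (rule ccontr)
      assume "\<not> ?thesis"
      then have le: "(m + int L) + int L \<le> n" by simp
      have "N \<le> m" using N nm g by auto
      then have "X m + 2 * W \<le> X ((m + int L) + int L)"
        using X_window[of m] X_window[of "m + int L"] by simp
      also have "\<dots> \<le> X n" using le by (rule X_mono)
      finally have "(X m + 2 * W) / W \<le> X n / W" using W0 by (intro divide_right_mono) auto
      then have "X m / W + 2 \<le> X n / W" using W0 by (simp add: add_divide_distrib)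
      moreover have "\<bar>X n / W - of_int j\<bar> < 1" "\<bar>X m / W - of_int j\<bar> < 1"
        using nm by (auto simp: g f_def tent_def max_def split: if_splits)
      ultimately show False by linarith
    qed
    show ?thesis using aux[OF that] aux[OF that(2,1)] by linarith
  qed
  define \<theta>' where "\<theta>' = \<theta> + of_int n\<^sub>0 * (\<alpha> - \<alpha>')"
  \<comment> \<open>The support has diameter below 2 L and a bond reaches one site further, which 3
    L accommodates. The factor 3 of \<open>jac_diff_norm\<close> then produces the 9 in the
    conclusion.\<close>
  define D where "D = \<Lambda> * (3 * of_nat L * \<bar>\<alpha> - \<alpha>'\<bar>)"
  have D: "D \<ge> 0" using \<Lambda> by (simp add: D_def)
  have close: "\<bar>(\<theta> + of_int n * \<alpha>) - (\<theta>' + of_int n * \<alpha>')\<bar> \<le> 3 * of_nat L * \<bar>\<alpha> - \<alpha>'\<bar>"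
    if "coord (g j) n \<noteq> 0 \<or> coord (g j) (n + 1) \<noteq> 0" for n
  proof -
    have "\<bar>n - n\<^sub>0\<bar> \<le> 3 * int L"
      using that supp[of n n\<^sub>0] supp[of "n + 1" n\<^sub>0] n\<^sub>0 L by linarith
    then have "real_of_int \<bar>n - n\<^sub>0\<bar> \<le> real_of_int (3 * int L)" by (simp only: of_int_le_iff)
    then have "\<bar>real_of_int (n - n\<^sub>0)\<bar> \<le> 3 * of_nat L" by simp
    moreover have "(\<theta> + of_int n * \<alpha>) - (\<theta>' + of_int n * \<alpha>') = of_int (n - n\<^sub>0) * (\<alpha> - \<alpha>')"
      by (simp add: \<theta>'_def algebra_simps)
    ultimately show ?thesis by (simp add: abs_mult mult_right_mono)
  qed
  have "norm (H \<alpha> \<theta> (g j) - H \<alpha>' \<theta>' (g j)) \<le> 3 * D * norm (g j)"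
    unfolding H_def
  proof (rule jac_diff_norm)
    fix n
    show "\<bar>b (\<theta> + of_int n * \<alpha>) - b (\<theta>' + of_int n * \<alpha>')\<bar> \<le> D"
      if "coord (g j) n \<noteq> 0 \<or> coord (g j) (n + 1) \<noteq> 0"
      unfolding D_def using close[OF that] \<Lambda> by (intro order_trans[OF b_lip] mult_left_mono)
    show "\<bar>v (\<theta> + of_int n * \<alpha>) - v (\<theta>' + of_int n * \<alpha>')\<bar> \<le> D"
      if "coord (g j) n \<noteq> 0"
      unfolding D_def using close[of n] that \<Lambda> by (intro order_trans[OF v_lip] mult_left_mono) auto
  qed (fact D)
  moreover have "norm (H \<alpha>' \<theta>' (g j) - E *\<^sub>R g j) \<le> norm (S (g j)) + norm (H \<alpha> \<theta> (g j) - H \<alpha>' \<theta>' (g j))"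
    using norm_triangle_ineq4[of "S (g j)" "H \<alpha> \<theta> (g j) - H \<alpha>' \<theta>' (g j)"] by (simp add: S_def)
  ultimately have "norm (H \<alpha>' \<theta>' (g j) - E *\<^sub>R g j) \<le> (8 / W + 3 * D) * norm (g j)"
    using Sg by (simp add: algebra_simps)
  then have "\<exists>E'\<in>approx_spectrum UNIV (H \<alpha>'). \<bar>E' - E\<bar> \<le> 8 / W + 3 * D"
    by (intro symmetric_family.approx_spectrum_near[OF symmetric_H _ g0]) auto
  then show ?thesis by (simp add: D_def mult_ac)
qed

end

subsection \<open>Continued fraction convergents\<close>

text \<open>\<open>p/q\<close> and \<open>p'/q'\<close> are consecutive convergents of \<open>x\<close> and \<open>y\<close> is the corresponding
  complete quotient; the statements for \<open>1 < x\<close> serve the recursion \<open>x = a + 1/x'\<close>.\<close>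

lemma cf_convergent_matrix:
  assumes "x \<notin> \<rat>"
  shows "\<exists>p q p' q' :: int. \<exists>y>1. cf_convergent n x = of_int p / of_int q
    \<and> x * (of_int q * y + of_int q') = of_int p * y + of_int p' \<and> \<bar>p * q' - p' * q\<bar> = 1
    \<and> int n \<le> q \<and> 1 \<le> q \<and> 0 \<le> q' \<and> (1 < x \<longrightarrow> int n + 1 \<le> p \<and> 0 \<le> p')"
  using assms
proof (induction n arbitrary: x)
  case 0
  have f: "0 < frac x" "frac x < 1"
    using 0 by (auto simp: frac_lt_1 frac_gt_0_iff Ints_subset_Rats[THEN subsetD])
  have "x * (1 / frac x) = of_int \<lfloor>x\<rfloor> * (1 / frac x) + 1"
    using f by (simp add: frac_def field_simps)
  then show ?case
    using f by (intro exI[of _ "\<lfloor>x\<rfloor>"] exI[of _ 1] exI[of _ 1] exI[of _ 0] exI[of _ "1 / frac x"]) auto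
next
  case (Suc n)
  have f: "0 < frac x" "frac x < 1"
    using Suc.prems by (auto simp: frac_lt_1 frac_gt_0_iff Ints_subset_Rats[THEN subsetD])
  define x' where "x' = 1 / frac x"
  have x': "x' > 1" using f by (simp add: x'_def)
  have xx: "x = of_int \<lfloor>x\<rfloor> + 1 / x'" by (simp add: x'_def frac_def)
  have "x' \<notin> \<rat>"
  proof
    assume "x' \<in> \<rat>"
    then have "of_int \<lfloor>x\<rfloor> + 1 / x' \<in> \<rat>" by simp
    then show False using xx Suc.prems by simp
  qed
  then obtain p q p' q' :: int and y where h: "y > 1" "cf_convergent n x' = of_int p / of_int q"
    "x' * (of_int q * y + of_int q') = of_int p * y + of_int p'" "\<bar>p * q' - p' * q\<bar> = 1"
    "int n \<le> q" "1 \<le> q" "0 \<le> q'" "int n + 1 \<le> p" "0 \<le> p'"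
    using Suc.IH[of x'] x' by blast
  let ?a = "\<lfloor>x\<rfloor>"
  have p1: "p \<ge> 1" using h by simp
  have pos: "of_int p * y + of_int p' > 0" using h p1 by (intro add_pos_nonneg mult_pos_pos) auto
  have "cf_convergent (Suc n) x = of_int ?a + 1 / (of_int p / of_int q)"
    using h(2) by (simp add: x'_def)
  also have "\<dots> = of_int (?a * p + q) / of_int p" using p1 by (simp add: field_simps)
  finally have 1: "cf_convergent (Suc n) x = of_int (?a * p + q) / of_int p" .
  have "1 / x' * (of_int p * y + of_int p') = of_int q * y + of_int q'"
    unfolding h(3)[symmetric] using x' by simp
  then have 2: "x * (of_int p * y + of_int p') = of_int (?a * p + q) * y + of_int (?a * p' + q')"
    by (subst xx) (simp add: algebra_simps)
  \<comment> \<open>Numerators become denominators in the recursion, which reverses the sign of the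
    determinant; hence only its absolute value is tracked.\<close>
  have "(?a * p + q) * p' - (?a * p' + q') * p = - (p * q' - p' * q)" by (simp add: algebra_simps)
  then have 3: "\<bar>(?a * p + q) * p' - (?a * p' + q') * p\<bar> = 1" using h(4) by simp
  \<comment> \<open>The new denominator is the old numerator \<open>p\<close>, so growth of
    denominators is inherited from growth of numerators. The latter gains 1 per step because
    \<open>?a \<ge> 1\<close> and \<open>q \<ge> 1\<close>.\<close>
  have 4: "int (Suc n) + 1 \<le> ?a * p + q \<and> 0 \<le> ?a * p' + q'" if "1 < x"
  proof -
    have a: "?a \<ge> 1" using that by simp
    then have "1 * p \<le> ?a * p" using p1 by (intro mult_right_mono) auto
    moreover have "0 \<le> ?a * p'" using a h by simp
    moreover have "int (Suc n) = int n + 1" by simp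
    ultimately show ?thesis using h by linarith
  qed
  show ?case
    using 1 2 3 4 h p1 by (intro exI[of _ "?a * p + q"] exI[of _ p] exI[of _ "?a * p' + q'"] exI[of _ p'] exI[of _ y]) auto
qed

text \<open>The determinant of modulus 1 yields coprimality, and also the exact error 1/(d q) with
  \<open>d = q * y + q'\<close>, which is at least \<open>q\<close> because the complete quotient
  \<open>y\<close> exceeds 1.\<close>

lemma cf_convergent_approx:
  assumes "x \<notin> \<rat>"
  obtains p q :: int where "cf_convergent n x = of_int p / of_int q" "coprime p q"
    "int n \<le> q" "1 \<le> q" "\<bar>x - of_int p / of_int q\<bar> \<le> 1 / (of_int q)\<^sup>2"
proof -
  obtain p q p' q' :: int and y where h: "y > 1" "cf_convergent n x = of_int p / of_int q"
    "x * (of_int q * y + of_int q') = of_int p * y + of_int p'" "\<bar>p * q' - p' * q\<bar> = 1"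
    "int n \<le> q" "1 \<le> q" "0 \<le> q'"
    using cf_convergent_matrix[OF assms, of n] by blast
  have "coprime p q"
  proof (rule coprimeI)
    fix c assume "c dvd p" "c dvd q"
    then have "c dvd p * q' - p' * q" by (intro dvd_diff dvd_mult dvd_mult2)
    then show "is_unit c" using h(4) by (metis dvd_abs_iff)
  qed
  moreover have "\<bar>x - of_int p / of_int q\<bar> \<le> 1 / (of_int q)\<^sup>2"
  proof -
    define d where "d = of_int q * y + of_int q'"
    have d: "d \<ge> of_int q" "d > 0"
    proof -
      have "real_of_int q * 1 \<le> of_int q * y" using h by (intro mult_left_mono) auto
      moreover have "real_of_int q' \<ge> 0" using h by simp
      ultimately show "d \<ge> of_int q" unfolding d_def by linarith
      then show "d > 0" using h(6) by linarith
    qed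
    have "(x - of_int p / of_int q) * (d * of_int q) = x * d * of_int q - of_int p * d"
      using h by (simp add: field_simps)
    also have "\<dots> = of_int (p' * q - p * q')"
      unfolding d_def using h(3) by (simp add: algebra_simps)
    finally have eq: "(x - of_int p / of_int q) * (d * of_int q) = of_int (p' * q - p * q')" .
    have "\<bar>x - of_int p / of_int q\<bar> * (d * of_int q) = \<bar>(x - of_int p / of_int q) * (d * of_int q)\<bar>"
      using d h(6) by (simp add: abs_mult)
    also have "\<dots> = of_int \<bar>p' * q - p * q'\<bar>" unfolding eq by (simp only: of_int_abs)
    also have "\<dots> = 1" using h(4) by (simp add: abs_minus_commute)
    finally have "\<bar>x - of_int p / of_int q\<bar> = 1 / (d * of_int q)"
      using d h(6) by (simp add: field_simps)
    also have "\<dots> \<le> 1 / (of_int q)\<^sup>2"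
      unfolding power2_eq_square using d h(6) by (intro divide_left_mono mult_right_mono mult_pos_pos) auto
    finally show ?thesis .
  qed
  ultimately show thesis using that h by blast
qed

lemma cf_convergent_close:
  assumes "x \<notin> \<rat>" "d > 0"
  shows "\<forall>\<^sub>F n in sequentially. \<bar>cf_convergent n x - x\<bar> \<le> d"
proof -
  obtain N :: nat where N: "1 / d \<le> real N" using real_arch_simple by blast
  have "\<bar>cf_convergent n x - x\<bar> \<le> d" if n: "N \<le> n" for n
  proof -
    obtain p q :: int where pq: "cf_convergent n x = of_int p / of_int q" "int n \<le> q" "1 \<le> q"
      "\<bar>x - of_int p / of_int q\<bar> \<le> 1 / (of_int q)\<^sup>2"
      using cf_convergent_approx[OF assms(1), of n] by metis
    have "real N \<le> of_int q" using pq(2) n by linarith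
    then have "1 / d \<le> of_int q" using N by linarith
    also have "real_of_int q * 1 \<le> (of_int q)\<^sup>2" unfolding power2_eq_square using pq(3) by (intro mult_left_mono) auto
    finally have "1 / (of_int q)\<^sup>2 \<le> d" using assms(2) pq(3) by (simp add: field_simps)
    then show ?thesis using pq by (simp add: abs_minus_commute)
  qed
  then show ?thesis unfolding eventually_sequentially by blast
qed

subsection \<open>Ergodic sums of \<open>1 / |b|\<close>\<close>

context quasiperiodic
begin

text \<open>The points \<open>\<theta> + k \<alpha>\<close>, \<open>k < q\<close>, are spread evenly on the circle at scale \<open>1 / q\<close>, so
  over such a block \<open>1 / |b|\<close> sums to at least a multiple of \<open>q (1/2 + \<dots> + 1/q)\<close>.\<close>

lemma block_sum_ge:
  fixes p :: int and q :: nat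
  assumes pq: "coprime p (int q)" "0 < q" "\<bar>\<alpha> - of_int p / of_nat q\<bar> \<le> 1 / (of_nat q)\<^sup>2"
    and zero: "b x\<^sub>0 = 0" and K: "K > 0" "\<Lambda> \<le> K"
  shows "real q / K * (\<Sum>j<q. 1 / (real j + 2)) \<le> (\<Sum>k<q. 1 / max \<bar>b (\<theta> + of_nat k * \<alpha>)\<bar> (K / real q))"
proof -
  define c where "c = \<lfloor>real q * (\<theta> - x\<^sub>0)\<rfloor>"
  \<comment> \<open>The position of \<theta> + k p/q, rounded down, on the grid of mesh 1/q based at
    the zero \<open>x\<^sub>0\<close>, modulo 1. Coprimality makes \<open>s\<close> a permutation of
    \<open>{..<q}\<close>.\<close>
  define s where "s = (\<lambda>k. nat ((c + int k * p) mod int q))"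
  have s: "s k < q" "int (s k) = (c + int k * p) mod int q" for k
    using pq(2) by (simp_all add: s_def nat_less_iff)
  have inj: "inj_on s {..<q}"
  proof (rule inj_onI)
    fix k l assume kl: "k \<in> {..<q}" "l \<in> {..<q}" "s k = s l"
    then have "(c + int k * p) mod int q = (c + int l * p) mod int q"
      unfolding s(2)[symmetric] by simp
    then have "int q dvd (c + int k * p) - (c + int l * p)" by (simp add: mod_eq_dvd_iff)
    then have "int q dvd (int k - int l) * p" by (simp add: algebra_simps)
    then have "int q dvd int k - int l"
      using pq(1) by (simp add: coprime_dvd_mult_left_iff coprime_commute)
    then have "int k mod int q = int l mod int q" by (simp add: mod_eq_dvd_iff)
    then show "k = l" using kl by simp
  qed
  have bij: "bij_betw s {..<q} {..<q}"
    using inj endo_inj_surj[of "{..<q}" s] s(1) by (auto simp: bij_betw_def)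
  have "real q / K * (\<Sum>j<q. 1 / (real j + 2)) = (\<Sum>j<q. real q / (K * (real j + 2)))"
    by (simp add: sum_distrib_left)
  also have "\<dots> = (\<Sum>k<q. real q / (K * (real (s k) + 2)))"
    by (rule sum.reindex_bij_betw[OF bij, symmetric])
  also have "\<dots> \<le> (\<Sum>k<q. 1 / max \<bar>b (\<theta> + of_nat k * \<alpha>)\<bar> (K / real q))"
  proof (intro sum_mono)
    fix k assume k: "k \<in> {..<q}"
    define m where "m = (c + int k * p) div int q"
    have "of_int c + real k * of_int p = real_of_int (int q * m + int (s k))"
      unfolding m_def s(2) by simp
    then have ckp: "of_int c + real k * of_int p = real q * of_int m + real (s k)" by simp
    define r where "r = real q * (\<theta> - x\<^sub>0) - of_int c"
    have r: "0 \<le> r" "r < 1" unfolding r_def c_def by linarith+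
    have "real q * (\<theta> + of_nat k * \<alpha> - (x\<^sub>0 + of_int m))
        = real (s k) + r + real q * (real k * (\<alpha> - of_int p / of_nat q))"
    proof -
      have "real q * (real k * (\<alpha> - of_int p / of_nat q)) = real q * (real k * \<alpha>) - real k * of_int p"
        using pq(2) by (simp add: field_simps)
      then show ?thesis using ckp by (simp add: r_def algebra_simps)
    qed
    moreover have "\<bar>real q * (real k * (\<alpha> - of_int p / of_nat q))\<bar> \<le> 1"
    proof -
      have "\<bar>real q * (real k * (\<alpha> - of_int p / of_nat q))\<bar> \<le> real q * (real q * (1 / (of_nat q)\<^sup>2))"
        using k pq(3) by (simp only: abs_mult abs_of_nat) (intro mult_mono, auto)
      then show ?thesis using pq(2) by (simp add: power2_eq_square)
    qed
    \<comment> \<open>The 2 collects the rounding error \<open>r < 1\<close> and the drift over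
      fewer than q steps, each off by at most 1/q^2, scaled by q.\<close>
    ultimately have "\<bar>real q * (\<theta> + of_nat k * \<alpha> - (x\<^sub>0 + of_int m))\<bar> \<le> real (s k) + 2"
      using r by linarith
    then have "real q * \<bar>\<theta> + of_nat k * \<alpha> - (x\<^sub>0 + of_int m)\<bar> \<le> real (s k) + 2"
      by (simp only: abs_mult abs_of_nat)
    then have dist: "\<bar>\<theta> + of_nat k * \<alpha> - (x\<^sub>0 + of_int m)\<bar> \<le> (real (s k) + 2) / real q"
      using pq(2) by (simp add: pos_le_divide_eq mult.commute)
    have "\<bar>b (\<theta> + of_nat k * \<alpha>)\<bar> = \<bar>b (\<theta> + of_nat k * \<alpha>) - b (x\<^sub>0 + of_int m)\<bar>"
      by (simp add: b_per_int zero)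
    also have "\<dots> \<le> K * ((real (s k) + 2) / real q)"
      using K dist by (intro order_trans[OF b_lip] mult_mono) auto
    finally have "max \<bar>b (\<theta> + of_nat k * \<alpha>)\<bar> (K / real q) \<le> K * (real (s k) + 2) / real q"
      using K pq(2) by (auto simp: divide_right_mono)
    moreover have "0 < max \<bar>b (\<theta> + of_nat k * \<alpha>)\<bar> (K / real q)" using K pq(2) by (simp add: less_max_iff_disj)
    ultimately have "1 / (K * (real (s k) + 2) / real q) \<le> 1 / max \<bar>b (\<theta> + of_nat k * \<alpha>)\<bar> (K / real q)"
      by (intro divide_left_mono mult_pos_pos) auto
    then show "real q / (K * (real (s k) + 2)) \<le> 1 / max \<bar>b (\<theta> + of_nat k * \<alpha>)\<bar> (K / real q)" by simp
  qed
  finally show ?thesis .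
qed

text \<open>The divergence of the harmonic series allows one convergent denominator \<open>Q\<close>
  whose blocks sum to at least \<open>2 * \<omega> * Q\<close>, uniformly in the phase. A longer
  window consists of such blocks up to a remainder shorter than half of it, which the factor 2 pays
  for. The floor \<open>\<kappa>\<close> is \<open>K / Q\<close> and so depends on
  \<open>\<omega>\<close>.\<close>

lemma window_sum_superlinear:
  assumes \<alpha>: "\<alpha> \<notin> \<rat>" and zero: "b x\<^sub>0 = 0" and \<omega>: "\<omega> > 0"
  shows "\<exists>\<kappa>>0. \<exists>L\<^sub>0. \<forall>L\<ge>L\<^sub>0. \<forall>\<theta>. \<omega> * real L \<le> (\<Sum>k<L. 1 / max \<bar>b (\<theta> + of_nat k * \<alpha>)\<bar> \<kappa>)"
proof -
  define K where "K = \<bar>\<Lambda>\<bar> + 1"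
  have K: "K > 0" "\<Lambda> \<le> K" by (auto simp: K_def)
  define h where "h = (\<lambda>n. \<Sum>j<n. 1 / (real j + 2))"
  have h_mono: "h m \<le> h n" if "m \<le> n" for m n
    unfolding h_def using that by (intro sum_mono2) auto
  have "\<exists>n. 2 * \<omega> * K \<le> h n"
  proof -
    have "ln (real n + 1) \<le> h n + 1" for n
    proof -
      have "harm (Suc n) = h n + 1"
        by (induction n) (simp_all add: harm_Suc h_def inverse_eq_divide add_ac harm_def)
      moreover have "ln (real (Suc n) + 1) \<le> harm (Suc n)" by (rule ln_le_harm)
      moreover have "ln (real n + 1) \<le> ln (real (Suc n) + 1)" by simp
      ultimately show ?thesis by linarith
    qed
    moreover obtain n :: nat where "exp (2 * \<omega> * K + 1) \<le> real n"
      using real_arch_simple by blast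
    then have "2 * \<omega> * K + 1 \<le> ln (real n + 1)"
      by (subst ln_ge_iff) auto
    ultimately have "2 * \<omega> * K + 1 \<le> h n + 1" by (rule order_trans[rotated])
    then have "2 * \<omega> * K \<le> h n" by simp
    then show ?thesis ..
  qed
  then obtain n where n: "2 * \<omega> * K \<le> h n" ..
  obtain p q :: int where pq: "coprime p q" "int n \<le> q" "1 \<le> q"
    "\<bar>\<alpha> - of_int p / of_int q\<bar> \<le> 1 / (of_int q)\<^sup>2"
    using cf_convergent_approx[OF \<alpha>, of n] by metis
  define Q where "Q = nat q"
  have Q: "q = int Q" "0 < Q" "n \<le> Q" using pq by (auto simp: Q_def)
  define F where "F = (\<lambda>\<theta> k. 1 / max \<bar>b (\<theta> + of_nat k * \<alpha>)\<bar> (K / real Q))"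
  have F0: "0 \<le> F \<theta> k" for \<theta> k using K Q by (auto simp: F_def le_max_iff_disj)
  have block: "2 * \<omega> * real Q \<le> (\<Sum>k<Q. F \<theta> k)" for \<theta>
  proof -
    have "2 * \<omega> * real Q = real Q / K * (2 * \<omega> * K)" using K by simp
    also have "\<dots> \<le> real Q / K * h Q"
      using K n h_mono[OF Q(3)] by (intro mult_left_mono) auto
    also have "\<dots> \<le> (\<Sum>k<Q. F \<theta> k)"
      unfolding h_def F_def using pq Q zero K by (intro block_sum_ge) auto
    finally show ?thesis .
  qed
  have "\<omega> * real L \<le> (\<Sum>k<L. F \<theta> k)" if L: "L \<ge> Q" for L \<theta>
  proof -
    define m where "m = L div Q"
    have m: "m * Q \<le> L" "L < (m + 1) * Q" "m \<ge> 1"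
      using L Q by (auto simp: m_def div_greater_zero_iff Suc_le_eq dividend_less_div_times)
    have "1 * Q \<le> m * Q" using m(3) by (intro mult_right_mono) auto
    then have "L \<le> 2 * (m * Q)" using m(2) unfolding add_mult_distrib by linarith
    then have "real L \<le> 2 * (real m * real Q)" by (metis of_nat_mono of_nat_mult of_nat_numeral)
    then have "\<omega> * real L \<le> real m * (2 * \<omega> * real Q)"
      using \<omega> mult_left_mono[of "real L" "2 * (real m * real Q)" \<omega>] by (simp add: algebra_simps)
    also have "\<dots> = (\<Sum>i<m. 2 * \<omega> * real Q)" by simp
    also have "\<dots> \<le> (\<Sum>i<m. \<Sum>k\<in>{i * Q..<i * Q + Q}. F \<theta> k)"
    proof (intro sum_mono)
      fix i
      have "(\<Sum>k\<in>{i * Q..<i * Q + Q}. F \<theta> k) = (\<Sum>k<Q. F \<theta> (k + i * Q))"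
        using sum.shift_bounds_nat_ivl[of "F \<theta>" 0 "i * Q" Q] by (simp add: add.commute lessThan_atLeast0)
      also have "\<dots> = (\<Sum>k<Q. F (\<theta> + of_nat (i * Q) * \<alpha>) k)"
        by (simp add: F_def algebra_simps)
      finally show "2 * \<omega> * real Q \<le> (\<Sum>k\<in>{i * Q..<i * Q + Q}. F \<theta> k)"
        using block by simp
    qed
    also have "\<dots> = (\<Sum>k<m * Q. F \<theta> k)" by (rule sum.nat_group)
    also have "\<dots> \<le> (\<Sum>k<L. F \<theta> k)" using m F0 by (intro sum_mono2) auto
    finally show ?thesis .
  qed
  moreover have "K / real Q > 0" using K Q by simp
  ultimately show ?thesis unfolding F_def by blast
qed

end

subsection \<open>Rational frequencies\<close>

text \<open>With C the sum of squares and s the vector with coefficients \<open>l (g x)\<close>, one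
  has C^2 = l(s)^2 \<le> |s|^2 \<le> C + m^2 \<tau> for m = \<open>card F\<close>, which bounds C.
  It serves to count approximate eigenvectors in a space of known dimension.\<close>

lemma almost_orthonormal_bessel:
  fixes g :: "'a \<Rightarrow> 'h::real_inner"
  assumes F: "finite F" and unit: "\<And>x. x \<in> F \<Longrightarrow> norm (g x) = 1"
    and orth: "\<And>x y. x \<in> F \<Longrightarrow> y \<in> F \<Longrightarrow> x \<noteq> y \<Longrightarrow> \<bar>g x \<bullet> g y\<bar> \<le> \<tau>" and \<tau>: "0 \<le> \<tau>"
    and l: "linear l" "\<And>z. \<bar>l z\<bar> \<le> norm z"
  shows "(\<Sum>x\<in>F. (l (g x))\<^sup>2) \<le> 1 + (real (card F))\<^sup>2 * \<tau>"
proof (rule ccontr)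
  define C where "C = (\<Sum>x\<in>F. (l (g x))\<^sup>2)"
  define s where "s = (\<Sum>x\<in>F. l (g x) *\<^sub>R g x)"
  have ls: "l s = C"
    unfolding s_def C_def using l(1) by (simp add: linear_sum linear_scale power2_eq_square)
  have le1: "\<bar>l (g x)\<bar> \<le> 1" if "x \<in> F" for x using l(2)[of "g x"] unit[OF that] by simp
  have "(norm s)\<^sup>2 = (\<Sum>x\<in>F. \<Sum>y\<in>F. l (g x) * l (g y) * (g x \<bullet> g y))"
    by (simp add: s_def power2_norm_eq_inner inner_sum_left inner_sum_right sum_distrib_left inner_commute mult_ac)
  also have "\<dots> \<le> (\<Sum>x\<in>F. \<Sum>y\<in>F. (if x = y then (l (g x))\<^sup>2 else 0) + \<tau>)"
  proof (intro sum_mono)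
    fix x y assume xy: "x \<in> F" "y \<in> F"
    show "l (g x) * l (g y) * (g x \<bullet> g y) \<le> (if x = y then (l (g x))\<^sup>2 else 0) + \<tau>"
    proof (cases "x = y")
      case True
      then show ?thesis using unit[OF xy(1)] \<tau> by (simp add: power2_eq_square norm_eq_1)
    next
      case False
      have "l (g x) * l (g y) * (g x \<bullet> g y) \<le> \<bar>l (g x) * l (g y)\<bar> * \<bar>g x \<bullet> g y\<bar>"
        unfolding abs_mult[symmetric] by (rule abs_ge_self)
      also have "\<dots> \<le> 1 * \<tau>"
        using le1[OF xy(1)] le1[OF xy(2)] orth[OF xy False]
        by (intro mult_mono) (auto simp: abs_mult mult_le_one)
      finally show ?thesis using False by simp
    qed
  qed
  also have "\<dots> = C + (real (card F))\<^sup>2 * \<tau>"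
    using F by (simp add: sum.distrib C_def power2_eq_square mult.assoc)
  finally have "C\<^sup>2 \<le> C + (real (card F))\<^sup>2 * \<tau>"
    using power_mono[OF l(2)[of s], of 2] ls by simp
  moreover assume "\<not> (\<Sum>x\<in>F. (l (g x))\<^sup>2) \<le> 1 + (real (card F))\<^sup>2 * \<tau>"
  then have *: "C > 1 + (real (card F))\<^sup>2 * \<tau>" by (simp add: C_def)
  have nn: "0 \<le> (real (card F))\<^sup>2 * \<tau>" using \<tau> by simp
  have "C + (real (card F))\<^sup>2 * \<tau> < C * C"
  proof -
    have "C * (1 + (real (card F))\<^sup>2 * \<tau>) < C * C" using * nn by (intro mult_strict_left_mono) auto
    moreover have "1 * ((real (card F))\<^sup>2 * \<tau>) \<le> C * ((real (card F))\<^sup>2 * \<tau>)"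
      using * nn by (intro mult_right_mono) auto
    ultimately show ?thesis by (simp add: distrib_left)
  qed
  ultimately show False by (simp add: power2_eq_square)
qed

section \<open>Spectra of single fibres: dependence on the phase, and counting\<close>

context quasiperiodic
begin

text \<open>A phase shift moves all coefficients by at most
  \<open>\<Lambda> * \<bar>\<theta> - \<theta>'\<bar>\<close>, uniformly over the sites, so no
  localisation intervenes.\<close>

lemma fibre_near:
  assumes "E \<in> approx_spectrum {\<theta>} (H \<alpha>)" "\<epsilon> > 0"
  shows "\<exists>E'\<in>approx_spectrum {\<theta>'} (H \<alpha>). \<bar>E' - E\<bar> \<le> \<epsilon> + 3 * \<Lambda> * \<bar>\<theta> - \<theta>'\<bar>"
proof -
  obtain u where u: "u \<noteq> 0" "norm (H \<alpha> \<theta> u - E *\<^sub>R u) \<le> \<epsilon> * norm u"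
    using approx_spectrumD[OF assms] by (metis singletonD)
  have \<Lambda>: "\<Lambda> \<ge> 0" using b_lip[of 1 0] by simp
  have "norm (H \<alpha> \<theta> u - H \<alpha> \<theta>' u) \<le> 3 * (\<Lambda> * \<bar>\<theta> - \<theta>'\<bar>) * norm u"
    unfolding H_def
  proof (rule jac_diff_norm)
    fix n
    show "\<bar>b (\<theta> + of_int n * \<alpha>) - b (\<theta>' + of_int n * \<alpha>)\<bar> \<le> \<Lambda> * \<bar>\<theta> - \<theta>'\<bar>"
      using b_lip[of "\<theta> + of_int n * \<alpha>" "\<theta>' + of_int n * \<alpha>"] by simp
    show "\<bar>v (\<theta> + of_int n * \<alpha>) - v (\<theta>' + of_int n * \<alpha>)\<bar> \<le> \<Lambda> * \<bar>\<theta> - \<theta>'\<bar>"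
      using v_lip[of "\<theta> + of_int n * \<alpha>" "\<theta>' + of_int n * \<alpha>"] by simp
  qed (use \<Lambda> in simp)
  moreover have "norm (H \<alpha> \<theta>' u - E *\<^sub>R u)
      \<le> norm (H \<alpha> \<theta> u - E *\<^sub>R u) + norm (H \<alpha> \<theta> u - H \<alpha> \<theta>' u)"
    using norm_triangle_ineq4[of "H \<alpha> \<theta> u - E *\<^sub>R u" "H \<alpha> \<theta> u - H \<alpha> \<theta>' u"] by simp
  ultimately have "norm (H \<alpha> \<theta>' u - E *\<^sub>R u) \<le> (\<epsilon> + 3 * \<Lambda> * \<bar>\<theta> - \<theta>'\<bar>) * norm u"
    using u(2) by (simp add: algebra_simps)
  then show ?thesis
    by (intro symmetric_family.approx_spectrum_near[OF symmetric_H _ u(1)]) auto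
qed

text \<open>Between two points outside the spectrum of the direct sum, the spectra of the fibres cannot
  appear or disappear as the phase moves.\<close>

lemma fibre_meets:
  assumes E1: "E1 \<notin> approx_spectrum UNIV (H \<alpha>)" and E2: "E2 \<notin> approx_spectrum UNIV (H \<alpha>)"
    and E: "E \<in> approx_spectrum UNIV (H \<alpha>)" "E1 \<le> E" "E \<le> E2"
  shows "\<exists>E'\<in>approx_spectrum {\<theta>\<^sub>0} (H \<alpha>). E1 \<le> E' \<and> E' \<le> E2"
proof -
  let ?sp = "approx_spectrum UNIV (H \<alpha>)"
  have sub: "approx_spectrum {\<theta>} (H \<alpha>) \<subseteq> ?sp" for \<theta> by (rule approx_spectrum_mono) simp
  have op: "open (- ?sp)" using closed_approx_spectrum by (simp add: open_closed)
  obtain d1 where d1: "d1 > 0" "ball E1 d1 \<subseteq> - ?sp" using op E1 by (meson ComplI openE)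
  obtain d2 where d2: "d2 > 0" "ball E2 d2 \<subseteq> - ?sp" using op E2 by (meson ComplI openE)
  define d where "d = min d1 d2"
  have d: "d > 0" "\<And>x. x \<in> ?sp \<Longrightarrow> d \<le> \<bar>E1 - x\<bar> \<and> d \<le> \<bar>E2 - x\<bar>"
    using d1 d2 by (force simp: d_def dist_real_def subset_iff not_less)+
  have \<Lambda>: "\<Lambda> \<ge> 0" using b_lip[of 1 0] by simp
  \<comment> \<open>A phase step of \<open>r\<close> costs at most \<open>d / 2\<close>, leaving
    \<open>d / 2\<close> for the slack in \<open>fibre_near\<close>; the summand 1 covers
    \<open>\<Lambda> = 0\<close>.\<close>
  define r where "r = d / (2 * (3 * \<Lambda> + 1))"
  have r: "r > 0" "3 * \<Lambda> * r \<le> d / 2"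
    using d(1) \<Lambda> by (auto simp: r_def field_simps)
  define P where "P = (\<lambda>\<theta>. \<exists>E'\<in>approx_spectrum {\<theta>} (H \<alpha>). E1 \<le> E' \<and> E' \<le> E2)"
  \<comment> \<open>Both \<open>x\<close> and \<open>y\<close> keep distance \<open>d\<close> from
    \<open>E1\<close> and \<open>E2\<close>, so crossing an endpoint would take a jump of at least 2
    d.\<close>
  have move: "P \<theta>'" if x: "x \<in> ?sp" "E1 \<le> x" "x \<le> E2" and y: "y \<in> approx_spectrum {\<theta>'} (H \<alpha>)" "\<bar>y - x\<bar> \<le> d"
    for x y \<theta>'
  proof -
    have "E1 \<le> y" "y \<le> E2" using d(2)[OF x(1)] x(2,3) y(2) by linarith+
    then show ?thesis unfolding P_def using y(1) by blast
  qed
  have step: "P \<theta>'" if "P \<theta>" "\<bar>\<theta> - \<theta>'\<bar> \<le> r" for \<theta> \<theta>'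
  proof -
    obtain x where x: "x \<in> approx_spectrum {\<theta>} (H \<alpha>)" "E1 \<le> x" "x \<le> E2"
      using \<open>P \<theta>\<close> by (auto simp: P_def)
    obtain y where y: "y \<in> approx_spectrum {\<theta>'} (H \<alpha>)" "\<bar>y - x\<bar> \<le> d / 2 + 3 * \<Lambda> * \<bar>\<theta> - \<theta>'\<bar>"
      using fibre_near[OF x(1), of "d / 2"] d(1) by auto
    have "3 * \<Lambda> * \<bar>\<theta> - \<theta>'\<bar> \<le> 3 * \<Lambda> * r" using that(2) \<Lambda> by (intro mult_left_mono) auto
    then have "\<bar>y - x\<bar> \<le> d" using y(2) r(2) by linarith
    then show ?thesis using move x sub y(1) by blast
  qed
  have iter: "P \<theta>'" if "P \<theta>" "\<bar>\<theta> - \<theta>'\<bar> \<le> real n * r" for n \<theta> \<theta>'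
    using that
  proof (induction n arbitrary: \<theta>')
    case 0
    then show ?case by simp
  next
    case (Suc n)
    define \<theta>'' where "\<theta>'' = \<theta> + (\<theta>' - \<theta>) * (real n / real (Suc n))"
    have "\<theta> - \<theta>'' = - ((\<theta>' - \<theta>) * (real n / real (Suc n)))" by (simp add: \<theta>''_def)
    then have "\<bar>\<theta> - \<theta>''\<bar> = \<bar>\<theta> - \<theta>'\<bar> * (real n / real (Suc n))" by (simp add: abs_mult abs_minus_commute)
    also have "\<dots> \<le> (real (Suc n) * r) * (real n / real (Suc n))"
      using Suc.prems by (intro mult_right_mono) auto
    also have "\<dots> = real n * r" by simp
    finally have "P \<theta>''" using Suc by blast
    moreover have "\<theta>'' - \<theta>' = (\<theta> - \<theta>') * (1 / real (Suc n))"
      by (simp add: \<theta>''_def field_simps)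
    then have "\<bar>\<theta>'' - \<theta>'\<bar> = \<bar>\<theta> - \<theta>'\<bar> * (1 / real (Suc n))" by (simp add: abs_mult)
    then have "\<bar>\<theta>'' - \<theta>'\<bar> \<le> (real (Suc n) * r) * (1 / real (Suc n))"
      using Suc.prems by (simp only:) (intro mult_right_mono, auto)
    then have "\<bar>\<theta>'' - \<theta>'\<bar> \<le> r" by simp
    ultimately show ?case by (rule step)
  qed
  obtain \<theta> u where u: "u \<noteq> 0" "norm (H \<alpha> \<theta> u - E *\<^sub>R u) \<le> d * norm u"
    using approx_spectrumD[OF E(1) d(1)] by metis
  then obtain y where y: "y \<in> approx_spectrum {\<theta>} (H \<alpha>)" "\<bar>y - E\<bar> \<le> d"
    using symmetric_family.approx_spectrum_near[OF symmetric_H, of \<theta> "{\<theta>}" u \<alpha> E d] by auto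
  then have "P \<theta>" using move[OF E(1)] E by blast
  moreover obtain n :: nat where "\<bar>\<theta> - \<theta>\<^sub>0\<bar> / r \<le> real n" using real_arch_simple by blast
  then have "\<bar>\<theta> - \<theta>\<^sub>0\<bar> \<le> real n * r" using r(1) by (simp add: field_simps)
  ultimately have "P \<theta>\<^sub>0" by (rule iter)
  then show ?thesis by (simp add: P_def)
qed

text \<open>If \<open>b \<theta>\<^sub>0 = 0\<close> and \<open>\<alpha> = p / q\<close>, the operator splits into identical blocks on
  \<open>{k q + 1..k q + q}\<close>.\<close>

lemma block_vector:
  fixes p :: int and q :: nat
  assumes q: "0 < q" and zero: "b \<theta>\<^sub>0 = 0" and \<alpha>: "\<alpha> = of_int p / of_nat q"
    and E: "E \<in> approx_spectrum {\<theta>\<^sub>0} (H \<alpha>)" and \<epsilon>: "\<epsilon> > 0"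
  shows "\<exists>g. norm g = 1 \<and> (\<forall>n. n \<notin> {1..int q} \<longrightarrow> coord g n = 0) \<and> norm (H \<alpha> \<theta>\<^sub>0 g - E *\<^sub>R g) \<le> \<epsilon>"
proof -
  define S where "S = (\<lambda>u. H \<alpha> \<theta>\<^sub>0 u - E *\<^sub>R u)"
  obtain u where u: "u \<noteq> 0" "norm (S u) \<le> \<epsilon> / 2 * norm u"
    using approx_spectrumD[OF E, of "\<epsilon> / 2"] \<epsilon> unfolding S_def by (metis half_gt_zero singletonD)
  have arg: "\<theta>\<^sub>0 + of_int (n + k * int q) * \<alpha> = (\<theta>\<^sub>0 + of_int n * \<alpha>) + of_int (k * p)" for n k
    using q by (simp add: \<alpha> field_simps)
  define \<beta> where "\<beta> = (\<lambda>n. b (\<theta>\<^sub>0 + of_int n * \<alpha>))"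
  define \<nu> where "\<nu> = (\<lambda>n. v (\<theta>\<^sub>0 + of_int n * \<alpha>))"
  have per: "\<beta> (n + k * int q) = \<beta> n" "\<nu> (n + k * int q) = \<nu> n" for n k
    unfolding \<beta>_def \<nu>_def arg by (simp_all only: b_per_int v_per_int)
  \<comment> \<open>\<open>\<beta> n\<close> couples \<open>n\<close> with \<open>n + 1\<close>, so
    the bonds at both ends of \<open>{1..int q}\<close> are cut and \<open>S\<close> commutes with
    restriction to a block.\<close>
  have \<beta>0: "\<beta> 0 = 0" "\<beta> (int q) = 0"
    using zero per(1)[of 0 1] by (simp_all add: \<beta>_def)
  have S: "coord (S w) n = of_real (\<beta> (n - 1)) * coord w (n - 1) + of_real (\<beta> n) * coord w (n + 1)
      + of_real (\<nu> n) * coord w n - of_real E * coord w n" for w n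
    by (simp add: S_def H_def coord_jac coord_ops \<beta>_def \<nu>_def scaleR_conv_of_real)
  define g where "g = (\<lambda>k. Abs_fsupp (\<lambda>n. if n \<in> {1..int q} then coord u (n + k * int q) else 0))"
  have g: "coord (g k) n = (if n \<in> {1..int q} then coord u (n + k * int q) else 0)" for k n
    unfolding g_def by (rule coord_Abs[of "{1..int q}"]) auto
  have Sg: "coord (S (g k)) n = (if n \<in> {1..int q} then coord (S u) (n + k * int q) else 0)" for k n
  proof (cases "n \<in> {1..int q}")
    case True
    have "of_real (\<beta> (n - 1)) * coord (g k) (n - 1) = of_real (\<beta> (n - 1)) * coord u (n - 1 + k * int q)"
      using True \<beta>0(1) by (cases "n = 1") (simp_all add: g)
    moreover have "of_real (\<beta> n) * coord (g k) (n + 1) = of_real (\<beta> n) * coord u (n + 1 + k * int q)"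
      using True \<beta>0(2) by (cases "n = int q") (simp_all add: g)
    moreover have "coord (g k) n = coord u (n + k * int q)" using True by (simp add: g)
    moreover have "n + k * int q - 1 = n - 1 + k * int q" "n + k * int q + 1 = n + 1 + k * int q" by simp_all
    ultimately show ?thesis using True by (simp only: S per if_True)
  next
    case False
    have "of_real (\<beta> (n - 1)) * coord (g k) (n - 1) = 0"
    proof (cases "n = int q + 1")
      case False
      then have "n - 1 \<notin> {1..int q}" using \<open>n \<notin> {1..int q}\<close> by auto
      then show ?thesis by (simp only: g if_False mult_zero_right)
    qed (simp add: \<beta>0)
    moreover have "of_real (\<beta> n) * coord (g k) (n + 1) = 0"
    proof (cases "n = 0")
      case False
      then have "n + 1 \<notin> {1..int q}" using \<open>n \<notin> {1..int q}\<close> by auto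
      then show ?thesis by (simp only: g if_False mult_zero_right)
    qed (simp add: \<beta>0)
    moreover have "coord (g k) n = 0" using False by (simp only: g if_False)
    ultimately show ?thesis using False by (simp only: S if_False) simp
  qed
  define c where "c = (\<lambda>(k, n). n + k * int q)"
  have inj: "inj_on c (A \<times> {1..int q})" for A
  proof (rule inj_onI, clarsimp simp: c_def)
    fix k n k' n' assume *: "1 \<le> n" "n \<le> int q" "1 \<le> n'" "n' \<le> int q" "n + k * int q = n' + k' * int q"
    have div: "(i - 1 + l * int q) div int q = l" if "1 \<le> i" "i \<le> int q" for i l
      using that q div_pos_pos_trivial[of "i - 1" "int q"] by simp
    have "n - 1 + k * int q = n' - 1 + k' * int q" using *(5) by linarith
    then have "k = k'" using div[OF *(1,2), of k] div[OF *(3,4), of k'] by metis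
    then show "k = k' \<and> n = n'" using *(5) by simp
  qed
  have cover: "m = c ((m - 1) div int q, (m - 1) mod int q + 1)" for m
    by (simp add: c_def algebra_simps)
  define A where "A = (\<lambda>m. (m - 1) div int q) ` {m. coord u m \<noteq> 0}"
  have A: "finite A" by (simp add: A_def finite_supp)
  have sum_c: "(\<Sum>k\<in>A. \<Sum>n\<in>{1..int q}. f (n + k * int q)) = (\<Sum>m\<in>c ` (A \<times> {1..int q}). f m)" for f :: "int \<Rightarrow> real"
    by (subst sum.reindex[OF inj]) (simp add: c_def sum.cartesian_product case_prod_unfold)
  have mass: "(\<Sum>k\<in>A. (norm (g k))\<^sup>2) = (norm u)\<^sup>2"
  proof -
    have "(\<Sum>k\<in>A. (norm (g k))\<^sup>2) = (\<Sum>k\<in>A. \<Sum>n\<in>{1..int q}. (cmod (coord u (n + k * int q)))\<^sup>2)"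
      by (intro sum.cong refl, subst norm_fsupp[of "{1..int q}"]) (auto simp: g)
    also have "\<dots> = (\<Sum>m\<in>c ` (A \<times> {1..int q}). (cmod (coord u m))\<^sup>2)" by (rule sum_c)
    also have "\<dots> = (norm u)\<^sup>2"
    proof (rule norm_fsupp[symmetric])
      show "finite (c ` (A \<times> {1..int q}))" using A by simp
      show "coord u m = 0" if "m \<notin> c ` (A \<times> {1..int q})" for m
      proof (rule ccontr)
        assume "coord u m \<noteq> 0"
        then have "((m - 1) div int q, (m - 1) mod int q + 1) \<in> A \<times> {1..int q}"
          using q by (auto simp: A_def zless_imp_add1_zle)
        then show False using that cover[of m] by blast
      qed
    qed
    finally show ?thesis .
  qed
  have err: "(\<Sum>k\<in>A. (norm (S (g k)))\<^sup>2) \<le> (norm (S u))\<^sup>2"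
  proof -
    have "(\<Sum>k\<in>A. (norm (S (g k)))\<^sup>2) = (\<Sum>k\<in>A. \<Sum>n\<in>{1..int q}. (cmod (coord (S u) (n + k * int q)))\<^sup>2)"
      by (intro sum.cong refl, subst norm_fsupp[of "{1..int q}"]) (auto simp: Sg)
    also have "\<dots> = (\<Sum>m\<in>c ` (A \<times> {1..int q}). (cmod (coord (S u) m))\<^sup>2)" by (rule sum_c)
    also have "\<dots> \<le> (norm (S u))\<^sup>2" using A by (intro sum_le_norm_fsupp) auto
    finally show ?thesis .
  qed
  \<comment> \<open>Averaging over the blocks; the halved accuracy \<open>\<epsilon> / 2\<close> of
    \<open>u\<close> makes the inequality strict, which in turn forces the chosen block vector to be
    nonzero.\<close>
  have "\<exists>k\<in>A. (norm (S (g k)))\<^sup>2 < \<epsilon>\<^sup>2 * (norm (g k))\<^sup>2"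
  proof (rule ccontr)
    assume "\<not> ?thesis"
    then have "(\<Sum>k\<in>A. \<epsilon>\<^sup>2 * (norm (g k))\<^sup>2) \<le> (\<Sum>k\<in>A. (norm (S (g k)))\<^sup>2)"
      by (intro sum_mono) (auto simp: not_less)
    also note err
    also have "(norm (S u))\<^sup>2 \<le> (\<epsilon> / 2 * norm u)\<^sup>2" using u(2) by (intro power_mono) auto
    finally have "\<epsilon>\<^sup>2 * (norm u)\<^sup>2 \<le> (\<epsilon> / 2 * norm u)\<^sup>2"
      unfolding sum_distrib_left[symmetric] mass .
    then show False using u(1) \<epsilon> by (simp add: power_mult_distrib power_divide)
  qed
  then obtain k where k: "(norm (S (g k)))\<^sup>2 < (\<epsilon> * norm (g k))\<^sup>2" by (auto simp: power_mult_distrib)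
  then have g0: "norm (g k) > 0" by auto
  have le: "norm (S (g k)) \<le> \<epsilon> * norm (g k)"
    using power_less_imp_less_base[OF k] \<epsilon> by auto
  define h where "h = (1 / norm (g k)) *\<^sub>R g k"
  have "S h = (1 / norm (g k)) *\<^sub>R S (g k)"
    using linear_jac by (simp add: S_def h_def H_def linear_scale scaleR_diff_right)
  then have "norm (S h) \<le> \<epsilon>" using le g0 by (simp add: field_simps)
  moreover have "norm h = 1" using g0 by (simp add: h_def)
  moreover have "coord h n = 0" if "n \<notin> {1..int q}" for n
    using that by (simp only: h_def coord_scaleR g if_False) simp
  ultimately show ?thesis unfolding S_def by blast
qed

text \<open>Approximate eigenvectors for distinct energies are almost orthogonal and live on one
  block, of real dimension 2 q. Summing Bessel's inequality over the real and imaginary parts of all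
  coordinates bounds their number.\<close>

lemma card_fibre_spectrum:
  fixes p :: int and q :: nat
  assumes q: "0 < q" and zero: "b \<theta>\<^sub>0 = 0" and \<alpha>: "\<alpha> = of_int p / of_nat q"
  shows "finite (approx_spectrum {\<theta>\<^sub>0} (H \<alpha>)) \<and> card (approx_spectrum {\<theta>\<^sub>0} (H \<alpha>)) \<le> 2 * q"
proof (rule finite_if_finite_subsets_card_bdd)
  fix F assume FE: "F \<subseteq> approx_spectrum {\<theta>\<^sub>0} (H \<alpha>)" and F: "finite F"
  define m where "m = real (card F)"
  obtain d where d: "d > 0" "\<And>x y. x \<in> F \<Longrightarrow> y \<in> F \<Longrightarrow> x \<noteq> y \<Longrightarrow> d \<le> \<bar>x - y\<bar>"
  proof
    let ?D = "insert 1 ((\<lambda>(x, y). \<bar>x - y\<bar>) ` {(x, y) \<in> F \<times> F. x \<noteq> y})"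
    have "finite {(x, y) \<in> F \<times> F. x \<noteq> y}" by (rule finite_subset[of _ "F \<times> F"]) (use F in auto)
    then have fin: "finite ?D" by simp
    show "0 < Min ?D" using fin by (subst Min_gr_iff) auto
    fix x y assume "x \<in> F" "y \<in> F" "x \<noteq> y"
    then have "\<bar>x - y\<bar> \<in> ?D" by (intro insertI2 image_eqI[of _ _ "(x, y)"]) auto
    with fin show "Min ?D \<le> \<bar>x - y\<bar>" by (rule Min_le)
  qed
  \<comment> \<open>Keeps the total Bessel error \<open>2 * q * m\<^sup>2 * \<tau>\<close> below 1,
    so that the integer \<open>card F\<close> cannot exceed \<open>2 * q\<close>.\<close>
  define \<tau> where "\<tau> = 1 / (4 * real q * (m\<^sup>2 + 1))"
  have m2: "0 < m\<^sup>2 + 1" by (simp add: add_nonneg_pos)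
  have \<tau>: "\<tau> > 0" using q m2 by (simp add: \<tau>_def)
  \<comment> \<open>By symmetry the inner product of two such vectors is at most the sum of their
    residuals divided by the energy gap, which is at least \<open>d\<close>; residuals of size
    \<open>\<tau> * d / 2\<close> therefore give \<open>\<tau>\<close>.\<close>
  have "0 < \<tau> * d / 2" using d(1) \<tau> by simp
  then have "\<forall>x\<in>F. \<exists>g. norm g = 1 \<and> (\<forall>n. n \<notin> {1..int q} \<longrightarrow> coord g n = 0)
      \<and> norm (H \<alpha> \<theta>\<^sub>0 g - x *\<^sub>R g) \<le> \<tau> * d / 2"
    using FE by (intro ballI block_vector[OF q zero \<alpha>]) auto
  from bchoice[OF this] obtain g where g: "\<And>x. x \<in> F \<Longrightarrow> norm (g x) = 1"
    "\<And>x n. x \<in> F \<Longrightarrow> n \<notin> {1..int q} \<Longrightarrow> coord (g x) n = 0"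
    "\<And>x. x \<in> F \<Longrightarrow> norm (H \<alpha> \<theta>\<^sub>0 (g x) - x *\<^sub>R g x) \<le> \<tau> * d / 2"
    by blast
  have orth: "\<bar>g x \<bullet> g y\<bar> \<le> \<tau>" if xy: "x \<in> F" "y \<in> F" "x \<noteq> y" for x y
  proof -
    let ?r = "\<lambda>x. H \<alpha> \<theta>\<^sub>0 (g x) - x *\<^sub>R g x"
    have "(x - y) * (g x \<bullet> g y) = g x \<bullet> ?r y - ?r x \<bullet> g y"
      by (simp add: H_def jac_sym inner_diff_left inner_diff_right algebra_simps)
    then have "\<bar>x - y\<bar> * \<bar>g x \<bullet> g y\<bar> \<le> \<bar>g x \<bullet> ?r y\<bar> + \<bar>?r x \<bullet> g y\<bar>"
      unfolding abs_mult[symmetric] by linarith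
    also have "\<dots> \<le> norm (g x) * norm (?r y) + norm (?r x) * norm (g y)"
      by (intro add_mono Cauchy_Schwarz_ineq2)
    also have "\<dots> \<le> \<tau> * d" using g(1)[OF xy(1)] g(1)[OF xy(2)] g(3)[OF xy(1)] g(3)[OF xy(2)] by simp
    finally have "\<bar>x - y\<bar> * \<bar>g x \<bullet> g y\<bar> \<le> \<tau> * d" .
    moreover have "d * \<bar>g x \<bullet> g y\<bar> \<le> \<bar>x - y\<bar> * \<bar>g x \<bullet> g y\<bar>"
      using d(2)[OF xy] by (intro mult_right_mono) auto
    ultimately have "d * \<bar>g x \<bullet> g y\<bar> \<le> d * \<tau>" by (simp add: mult.commute)
    then show ?thesis using d(1) by simp
  qed
  have cmod_le: "cmod (coord z n) \<le> norm z" for z n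
    by (rule power2_le_imp_le) (use sum_le_norm_fsupp[of "{n}" z] in simp_all)
  have bessel: "(\<Sum>x\<in>F. (l (g x))\<^sup>2) \<le> 1 + m\<^sup>2 * \<tau>" if "linear l" "\<And>z. \<bar>l z\<bar> \<le> norm z" for l
    unfolding m_def using F g(1) orth less_imp_le[OF \<tau>] that by (rule almost_orthonormal_bessel)
  have "m = (\<Sum>x\<in>F. (norm (g x))\<^sup>2)" by (simp add: m_def g)
  also have "\<dots> = (\<Sum>x\<in>F. \<Sum>n\<in>{1..int q}. (Re (coord (g x) n))\<^sup>2 + (Im (coord (g x) n))\<^sup>2)"
    using g(2) by (intro sum.cong refl, subst norm_fsupp[of "{1..int q}"]) (auto simp: cmod_power2)
  also have "\<dots> = (\<Sum>n\<in>{1..int q}. (\<Sum>x\<in>F. (Re (coord (g x) n))\<^sup>2) + (\<Sum>x\<in>F. (Im (coord (g x) n))\<^sup>2))"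
    by (subst sum.swap) (simp add: sum.distrib)
  also have "\<dots> \<le> (\<Sum>n\<in>{1..int q}. (1 + m\<^sup>2 * \<tau>) + (1 + m\<^sup>2 * \<tau>))"
  proof (intro sum_mono add_mono bessel)
    fix n z
    show "linear (\<lambda>z. Re (coord z n))" "linear (\<lambda>z. Im (coord z n))"
      by (rule linearI; simp add: coord_ops)+
    show "\<bar>Re (coord z n)\<bar> \<le> norm z" by (rule order_trans[OF abs_Re_le_cmod cmod_le])
    show "\<bar>Im (coord z n)\<bar> \<le> norm z" by (rule order_trans[OF abs_Im_le_cmod cmod_le])
  qed
  also have "\<dots> = 2 * real q + 2 * real q * (m\<^sup>2 * \<tau>)" by (simp add: algebra_simps)
  also have "2 * real q * (m\<^sup>2 * \<tau>) = m\<^sup>2 / (2 * (m\<^sup>2 + 1))"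
  proof -
    have aux: "2 * Q * (a * (1 / (4 * Q * N))) = a / (2 * N)" if "0 < Q" "0 < N" for Q N a :: real
      using that by (simp add: field_simps)
    show ?thesis unfolding \<tau>_def by (rule aux) (use q m2 in simp_all)
  qed
  also have "\<dots> < 1" using m2 by (simp add: divide_less_eq)
  finally have "real (card F) < real (2 * q + 1)" by (simp add: m_def)
  then show "card F \<le> 2 * q" by linarith
qed

end

subsection \<open>Lebesgue measure of neighbourhoods\<close>

text \<open>Every point of \<open>S\<close> is joined to a point of \<open>F\<close> by a segment in \<open>S\<close>, so \<open>S\<close> is a union of at
  most \<open>card F\<close> intervals.\<close>

lemma measure_neighbourhood_le:
  fixes S F A :: "real set"
  assumes S: "compact S" and F: "finite F" "F \<subseteq> S" and A: "A \<in> sets lebesgue"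
    and sep: "\<And>E1 E2 E. E1 \<notin> S \<Longrightarrow> E2 \<notin> S \<Longrightarrow> E \<in> S \<Longrightarrow> E1 \<le> E \<Longrightarrow> E \<le> E2 \<Longrightarrow> \<exists>x\<in>F. E1 \<le> x \<and> x \<le> E2"
    and near: "\<And>x. x \<in> A \<Longrightarrow> \<exists>y\<in>S. \<bar>y - x\<bar> \<le> \<eta>" and \<eta>: "0 \<le> \<eta>"
  shows "measure lebesgue A \<le> measure lebesgue S + 2 * \<eta> * card F"
proof -
  obtain M where M: "\<And>x. x \<in> S \<Longrightarrow> \<bar>x\<bar> \<le> M"
    using compact_imp_bounded[OF S] by (auto simp: bounded_iff)
  \<comment> \<open>For \<open>f\<close> in \<open>S\<close> this is the component of
    \<open>S\<close> that contains \<open>f\<close>.\<close>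
  define I where "I = (\<lambda>f. {x. closed_segment f x \<subseteq> S})"
  have I_sub: "I f \<subseteq> S" for f by (auto simp: I_def)
  have bdd: "bdd_below (I f)" "bdd_above (I f)" for f
  proof -
    have "x \<in> {-M..M}" if "x \<in> I f" for x using I_sub[of f] M[of x] that by (auto simp: abs_le_iff)
    then show "bdd_below (I f)" "bdd_above (I f)"
      by (auto intro: bdd_belowI[of _ "- M"] bdd_aboveI[of _ M])
  qed
  have seg: "\<exists>f\<in>F. E \<in> I f" if E: "E \<in> S" for E
  proof (rule ccontr)
    assume "\<not> ?thesis"
    then have "\<forall>f\<in>F. \<exists>z. z \<in> closed_segment f E \<and> z \<notin> S" by (auto simp: I_def)
    then obtain z where z: "\<And>f. f \<in> F \<Longrightarrow> z f \<in> closed_segment f E" "\<And>f. f \<in> F \<Longrightarrow> z f \<notin> S" by metis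
    \<comment> \<open>\<open>z f\<close> is a point off \<open>S\<close> between \<open>f\<close>
      and \<open>E\<close>. \<open>A1\<close> and \<open>A2\<close> collect these obstructions on
      either side of \<open>E\<close>, with sentinels beyond \<open>M\<close> to make both nonempty.
      By \<open>sep\<close> some \<open>f\<close> lies between the two nearest obstructions, yet its
      own \<open>z f\<close> would be nearer still.\<close>
    define A1 where "A1 = insert (- M - 1) (z ` {f \<in> F. z f \<le> E})"
    define A2 where "A2 = insert (M + 1) (z ` {f \<in> F. E \<le> z f})"
    have fin: "finite A1" "finite A2" using F by (auto simp: A1_def A2_def)
    have A1: "x \<notin> S \<and> x \<le> E" if "x \<in> A1" for x
      using that z(2) M[of x] M[OF E] by (auto simp: A1_def abs_le_iff)
    have A2: "x \<notin> S \<and> E \<le> x" if "x \<in> A2" for x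
      using that z(2) M[of x] M[OF E] by (auto simp: A2_def abs_le_iff)
    have m: "Max A1 \<in> A1" "Min A2 \<in> A2"
      using Max_in[OF fin(1)] Min_in[OF fin(2)] by (auto simp only: A1_def A2_def insert_not_empty)
    obtain f where f: "f \<in> F" "Max A1 \<le> f" "f \<le> Min A2"
      using sep[of "Max A1" "Min A2" E] A1[OF m(1)] A2[OF m(2)] E by blast
    have nf: "z f \<noteq> f" using z(2)[OF f(1)] F(2) f(1) by auto
    consider "f \<le> z f" "z f \<le> E" | "E \<le> z f" "z f \<le> f"
      using z(1)[OF f(1)] by (auto simp: closed_segment_eq_real_ivl split: if_splits)
    then show False
    proof cases
      case 1
      then have "z f \<le> Max A1" using f(1) fin by (intro Max_ge) (auto simp: A1_def)
      then show False using 1 f(2) nf by simp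
    next
      case 2
      then have "Min A2 \<le> z f" using f(1) fin by (intro Min_le) (auto simp: A2_def)
      then show False using 2 f(3) nf by simp
    qed
  qed
  define J where "J = (\<lambda>f. {Inf (I f) - \<eta>..Inf (I f)} \<union> {Sup (I f)..Sup (I f) + \<eta>})"
  have sub: "A \<subseteq> S \<union> (\<Union>f\<in>F. J f)"
  proof
    fix x assume "x \<in> A"
    then obtain y where y: "y \<in> S" "\<bar>y - x\<bar> \<le> \<eta>" using near by blast
    obtain f where f: "f \<in> F" "y \<in> I f" using seg[OF y(1)] by blast
    have I_mem: "w \<in> S" if "z \<in> I f" "w \<in> closed_segment f z" for w z using that by (auto simp: I_def)
    have ivl: "f \<le> w \<and> w \<le> z \<or> z \<le> w \<and> w \<le> f \<Longrightarrow> w \<in> closed_segment f z" for w z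
      by (auto simp: closed_segment_eq_real_ivl)
    show "x \<in> S \<union> (\<Union>f\<in>F. J f)"
    proof (cases "x \<in> S")
      case False
      have out: "\<not> (f \<le> x \<and> x \<le> z) \<and> \<not> (z \<le> x \<and> x \<le> f)" if "z \<in> I f" for z
        using I_mem[OF that ivl] False by blast
      consider "x < y" | "y < x" using False y(1) by force
      then have "x \<in> J f"
      proof cases
        case 1
        then have "x < f" using out[OF f(2)] by auto
        have "x \<le> Inf (I f)"
        proof (rule cInf_greatest)
          show "x \<le> z" if "z \<in> I f" for z using out[OF that] \<open>x < f\<close> by linarith
        qed (use f(2) in blast)
        moreover have "Inf (I f) \<le> y" using f(2) bdd by (intro cInf_lower)
        ultimately show ?thesis using y(2) by (auto simp: J_def)
      next
        case 2
        then have "f < x" using out[OF f(2)] by auto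
        have "Sup (I f) \<le> x"
        proof (rule cSup_least)
          show "z \<le> x" if "z \<in> I f" for z using out[OF that] \<open>f < x\<close> by linarith
        qed (use f(2) in blast)
        moreover have "y \<le> Sup (I f)" using f(2) bdd by (intro cSup_upper)
        ultimately show ?thesis using y(2) by (auto simp: J_def)
      qed
      then show ?thesis using f(1) by blast
    qed simp
  qed
  have SL: "S \<in> lmeasurable" using S by (rule lmeasurable_compact)
  have JL: "J f \<in> lmeasurable" for f by (auto simp: J_def intro!: fmeasurable.Un)
  have Jm: "measure lebesgue (J f) \<le> 2 * \<eta>" for f
  proof -
    have "measure lebesgue (J f) \<le> measure lebesgue {Inf (I f) - \<eta>..Inf (I f)}
        + measure lebesgue {Sup (I f)..Sup (I f) + \<eta>}"
      unfolding J_def by (rule measure_Un_le) auto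
    then show ?thesis using \<eta> by simp
  qed
  have UL: "(\<Union>f\<in>F. J f) \<in> lmeasurable" using F JL by (intro fmeasurable.finite_UN) auto
  have "measure lebesgue A \<le> measure lebesgue (S \<union> (\<Union>f\<in>F. J f))"
    using sub A SL UL by (intro measure_mono_fmeasurable fmeasurable.Un)
  also have "\<dots> \<le> measure lebesgue S + measure lebesgue (\<Union>f\<in>F. J f)"
    using SL UL by (intro measure_Un_le) (auto simp: fmeasurableD)
  also have "measure lebesgue (\<Union>f\<in>F. J f) \<le> (\<Sum>f\<in>F. measure lebesgue (J f))"
    using F JL by (intro measure_UNION_le) (auto simp: fmeasurableD)
  also have "\<dots> \<le> (\<Sum>f\<in>F. 2 * \<eta>)" by (intro sum_mono Jm)
  finally show ?thesis by (simp add: mult.commute)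
qed

text \<open>Outer regularity provides an open superset of \<open>S\<close> of excess measure below
  \<open>e\<close>; by compactness it contains a uniform neighbourhood of \<open>S\<close>.\<close>

lemma measure_upper_semicontinuous:
  fixes S :: "real set"
  assumes S: "compact S" and e: "e > 0"
  shows "\<exists>\<delta>>0. \<forall>A. A \<in> sets lebesgue \<longrightarrow> (\<forall>x\<in>A. \<exists>y\<in>S. \<bar>y - x\<bar> \<le> \<delta>)
    \<longrightarrow> measure lebesgue A \<le> measure lebesgue S + e"
proof -
  have SL: "S \<in> lmeasurable" using S by (rule lmeasurable_compact)
  obtain U where U: "open U" "S \<subseteq> U" "U - S \<in> lmeasurable" "emeasure lebesgue (U - S) < ennreal e"
    by (rule sets_lebesgue_outer_open[OF fmeasurableD[OF SL] e])
  obtain \<delta> where \<delta>: "\<delta> > 0" "(\<Union>x\<in>S. cball x \<delta>) \<subseteq> U"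
    using compact_subset_open_imp_cball_epsilon_subset[OF S U(1,2)] by blast
  have "measure lebesgue A \<le> measure lebesgue S + e"
    if A: "A \<in> sets lebesgue" "\<forall>x\<in>A. \<exists>y\<in>S. \<bar>y - x\<bar> \<le> \<delta>" for A
  proof -
    have "x \<in> U" if x: "x \<in> A" for x
    proof -
      obtain y where "y \<in> S" "\<bar>y - x\<bar> \<le> \<delta>" using A(2) x by blast
      then have "x \<in> (\<Union>x\<in>S. cball x \<delta>)" by (auto simp: dist_real_def)
      then show ?thesis using \<delta>(2) by blast
    qed
    then have "A \<subseteq> S \<union> (U - S)" by blast
    then have "measure lebesgue A \<le> measure lebesgue (S \<union> (U - S))"
      using A SL U(3) by (intro measure_mono_fmeasurable fmeasurable.Un)
    also have "\<dots> \<le> measure lebesgue S + measure lebesgue (U - S)"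
      using SL U(3) by (intro measure_Un_le) (auto simp: fmeasurableD)
    also have "measure lebesgue (U - S) \<le> e"
    proof -
      have "ennreal (measure lebesgue (U - S)) < ennreal e"
        using U(4) unfolding emeasure_eq_measure2[OF U(3)] .
      then show ?thesis by (simp add: ennreal_less_iff)
    qed
    finally show ?thesis by simp
  qed
  then show ?thesis using \<delta>(1) by blast
qed

subsection \<open>Continuity of the measure of the spectrum\<close>

text \<open>The derivative is itself periodic, by uniqueness, and continuous, hence bounded; the
  mean value inequality turns this bound into a Lipschitz constant.\<close>

lemma periodic_C1_bounds:
  fixes f :: "real \<Rightarrow> real"
  assumes C1: "f C1_differentiable_on UNIV" and per: "\<forall>x. f (x + 1) = f x"
  shows "\<exists>B L. (\<forall>x. \<bar>f x\<bar> \<le> B) \<and> (\<forall>x y. \<bar>f x - f y\<bar> \<le> L * \<bar>x - y\<bar>)"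
proof -
  obtain D where D: "\<And>x. (f has_real_derivative D x) (at x)" "continuous_on UNIV D"
    using C1 by (auto simp: C1_differentiable_on_def has_real_derivative_iff_has_vector_derivative)
  have "(f has_real_derivative D (x + 1)) (at x)" for x
  proof -
    have "((\<lambda>x. f (x + 1)) has_real_derivative D (x + 1)) (at x)"
      using DERIV_shift[of f "D (x + 1)" x 1] D(1) by simp
    then show ?thesis using per by simp
  qed
  then have D_per: "D (x + 1) = D x" for x using D(1) DERIV_unique by blast
  have bdd: "\<exists>K. \<forall>x. \<bar>g x\<bar> \<le> K" if g: "continuous_on UNIV g" "\<And>x. g (x + 1) = g x" for g :: "real \<Rightarrow> real"
  proof -
    have "compact (g ` {0..1})" using g(1) by (intro compact_continuous_image) (auto intro: continuous_on_subset)
    then obtain K where K: "\<And>x. x \<in> {0..1} \<Longrightarrow> \<bar>g x\<bar> \<le> K"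
      using compact_imp_bounded by (fastforce simp: bounded_iff)
    have "\<bar>g x\<bar> \<le> K" for x
    proof -
      have "g x = g (frac x)"
        using periodic_of_int[of g "frac x" "\<lfloor>x\<rfloor>"] g(2) by (simp add: frac_def)
      then show ?thesis using K[of "frac x"] by (simp add: frac_lt_1 less_imp_le)
    qed
    then show ?thesis by blast
  qed
  have "continuous_on UNIV f"
    using D(1) by (meson DERIV_continuous_on has_field_derivative_at_within)
  then obtain B where B: "\<And>x. \<bar>f x\<bar> \<le> B" using bdd per by blast
  obtain L where L: "\<And>x. \<bar>D x\<bar> \<le> L" using bdd[OF D(2) D_per] by blast
  have "\<bar>f x - f y\<bar> \<le> L * \<bar>x - y\<bar>" for x y
    using field_differentiable_bound[of UNIV f D L x y] D(1) L by (simp add: has_field_derivative_at_within)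
  then show ?thesis using B by blast
qed

context quasiperiodic
begin

abbreviation sp :: "real \<Rightarrow> real set" where
  "sp \<alpha> \<equiv> approx_spectrum UNIV (H \<alpha>)"

lemma compact_sp: "compact (sp \<alpha>)"
  using symmetric_family.compact_approx_spectrum[OF symmetric_H] .

lemma sets_sp: "sp \<alpha> \<in> sets lebesgue"
  using compact_sp by (auto intro: fmeasurableD lmeasurable_compact)

text \<open>Localisation is applied from the convergent towards \<alpha>. The target spectrum is
  fixed, so \<open>\<delta>\<close> and the window length \<open>L\<close> do not depend on
  \<open>n\<close>, and ordinary cut-offs suffice.\<close>

lemma limsup_measure:
  assumes \<alpha>: "\<alpha> \<notin> \<rat>" and e: "e > 0"
  shows "\<forall>\<^sub>F n in sequentially. measure lebesgue (sp (cf_convergent n \<alpha>)) \<le> measure lebesgue (sp \<alpha>) + e"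
proof -
  obtain \<delta> where \<delta>: "\<delta> > 0" "\<And>A. A \<in> sets lebesgue \<Longrightarrow> (\<And>x. x \<in> A \<Longrightarrow> \<exists>y\<in>sp \<alpha>. \<bar>y - x\<bar> \<le> \<delta>)
      \<Longrightarrow> measure lebesgue A \<le> measure lebesgue (sp \<alpha>) + e"
    using measure_upper_semicontinuous[OF compact_sp e] by metis
  \<comment> \<open>A floor above \<open>\<bar>b x\<bar>\<close> makes all weights equal to
    \<open>1 / \<kappa>\<close>, so the window sum is exactly \<open>L / \<kappa>\<close> for every
    frequency.\<close>
  define \<kappa> where "\<kappa> = B + 1"
  have \<kappa>: "\<kappa> > 0" using B_nonneg by (simp add: \<kappa>_def)
  have \<Lambda>: "\<Lambda> \<ge> 0" using b_lip[of 1 0] by simp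
  obtain L :: nat where L: "L \<ge> 1" "16 * \<kappa> / \<delta> \<le> real L"
    using real_arch_simple[of "max 1 (16 * \<kappa> / \<delta>)"] by auto
  define W where "W = real L / \<kappa>"
  have W: "1 / \<kappa> \<le> W" using L(1) \<kappa> by (simp add: W_def divide_right_mono)
  have W8: "8 / W \<le> \<delta> / 2" using L \<kappa> \<delta>(1) by (simp add: W_def field_simps)
  define d where "d = \<delta> / (2 * (9 * \<Lambda> * real L + 1))"
  have pos: "9 * \<Lambda> * real L + 1 > 0" using \<Lambda> by (simp add: add_nonneg_pos)
  have d: "d > 0" "9 * \<Lambda> * real L * d \<le> \<delta> / 2"
  proof -
    show "d > 0" using \<delta>(1) pos by (simp add: d_def)
    have "9 * \<Lambda> * real L * d \<le> (9 * \<Lambda> * real L + 1) * d" using \<open>d > 0\<close> by (intro mult_right_mono) auto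
    also have "\<dots> = \<delta> / 2"
    proof -
      have "y * (\<delta> / (2 * y)) = \<delta> / 2" if "y > 0" for y using that by simp
      then show ?thesis unfolding d_def using pos by blast
    qed
    finally show "9 * \<Lambda> * real L * d \<le> \<delta> / 2" .
  qed
  have "measure lebesgue (sp (cf_convergent n \<alpha>)) \<le> measure lebesgue (sp \<alpha>) + e"
    if close: "\<bar>cf_convergent n \<alpha> - \<alpha>\<bar> \<le> d" for n
  proof (rule \<delta>(2)[OF sets_sp])
    fix E assume E: "E \<in> sp (cf_convergent n \<alpha>)"
    let ?c = "cf_convergent n \<alpha>"
    have "max \<bar>b x\<bar> \<kappa> = \<kappa>" for x using b_bdd[of x] by (simp add: \<kappa>_def max_def)
    then have "W \<le> (\<Sum>k<L. 1 / max \<bar>b (\<theta> + of_nat k * ?c)\<bar> \<kappa>)" for \<theta>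
      by (simp add: W_def)
    then obtain y where y: "y \<in> sp \<alpha>" "\<bar>y - E\<bar> \<le> 8 / W + 9 * \<Lambda> * of_nat L * \<bar>?c - \<alpha>\<bar>"
      using localisation[OF \<kappa> W _ E] by blast
    have "9 * \<Lambda> * of_nat L * \<bar>?c - \<alpha>\<bar> \<le> 9 * \<Lambda> * of_nat L * d"
      using close \<Lambda> by (intro mult_left_mono) auto
    then show "\<exists>y\<in>sp \<alpha>. \<bar>y - E\<bar> \<le> \<delta>" using y W8 d(2) by (intro bexI[of _ y]) linarith+
  qed
  then show ?thesis using cf_convergent_close[OF \<alpha> d(1)] by (rule eventually_mono[rotated])
qed

lemma liminf_measure:
  assumes \<alpha>: "\<alpha> \<notin> \<rat>" and zero: "b x\<^sub>0 = 0" and e: "e > 0"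
  shows "\<forall>\<^sub>F n in sequentially. measure lebesgue (sp \<alpha>) \<le> measure lebesgue (sp (cf_convergent n \<alpha>)) + e"
proof -
  have \<Lambda>: "\<Lambda> \<ge> 0" using b_lip[of 1 0] by simp
  \<comment> \<open>The error to beat is \<open>4 * q * \<eta>\<close>: 2 \<eta> for each of at most
    2 q components. Its frequency part is \<open>72 * \<Lambda> * a\<close> and its cut-off part
    \<open>32 / (\<omega> * a)\<close>; \<open>a\<close>, and then \<open>\<omega>\<close>, make
    each at most \<open>e / 2\<close>.\<close>
  define a where "a = e / (144 * (\<Lambda> + 1))"
  have a: "a > 0" "72 * \<Lambda> * a \<le> e / 2"
    using e \<Lambda> by (auto simp: a_def field_simps)
  define \<omega> where "\<omega> = 64 / (a * e)"
  have \<omega>: "\<omega> > 0" "32 / (\<omega> * a) = e / 2" using a e by (auto simp: \<omega>_def)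
  obtain \<kappa> L\<^sub>0 where \<kappa>: "\<kappa> > 0"
    and win: "\<And>L \<theta>. L\<^sub>0 \<le> L \<Longrightarrow> \<omega> * real L \<le> (\<Sum>k<L. 1 / max \<bar>b (\<theta> + of_nat k * \<alpha>)\<bar> \<kappa>)"
    using window_sum_superlinear[OF \<alpha> zero \<omega>(1)] by blast
  \<comment> \<open>The bounds ensure, in order, that rounding \<open>a * q\<close> up at most
    doubles it, that the window reaches \<open>L\<^sub>0\<close>, and that
    \<open>1 / \<kappa> \<le> W\<close>.\<close>
  obtain N :: nat where N: "N \<ge> 1" "1 / a \<le> real N" "real L\<^sub>0 / a \<le> real N" "1 / (\<kappa> * \<omega> * a) \<le> real N"
    using real_arch_simple[of "Max {1, 1 / a, real L\<^sub>0 / a, 1 / (\<kappa> * \<omega> * a)}"] by auto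
  have "measure lebesgue (sp \<alpha>) \<le> measure lebesgue (sp (cf_convergent n \<alpha>)) + e" if n: "N \<le> n" for n
  proof -
    obtain p q' :: int where pq': "cf_convergent n \<alpha> = of_int p / of_int q'" "int n \<le> q'" "1 \<le> q'"
      "\<bar>\<alpha> - of_int p / of_int q'\<bar> \<le> 1 / (of_int q')\<^sup>2"
      using cf_convergent_approx[OF \<alpha>, of n] by metis
    define q where "q = nat q'"
    define \<alpha>' where "\<alpha>' = cf_convergent n \<alpha>"
    have q: "q > 0" "N \<le> q" "\<alpha>' = of_int p / of_nat q" "\<bar>\<alpha> - \<alpha>'\<bar> \<le> 1 / (real q)\<^sup>2"
      using pq' n by (auto simp: q_def \<alpha>'_def)
    have Nq: "real N \<le> real q" using q(2) by simp
    define L where "L = nat \<lceil>a * real q\<rceil>"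
    have L: "a * real q \<le> real L" "real L \<le> a * real q + 1"
      using a q(1) by (auto simp: L_def)
    have "1 / a \<le> real q" using N(2) Nq by linarith
    then have "1 \<le> a * real q" using a by (simp add: field_simps)
    then have L2: "real L \<le> 2 * a * real q" using L by simp
    have "real L\<^sub>0 \<le> a * real q"
    proof -
      have "real L\<^sub>0 / a \<le> real q" using N(3) Nq by linarith
      then show ?thesis using a by (simp add: field_simps)
    qed
    then have L0: "L\<^sub>0 \<le> L" using L by linarith
    define W where "W = \<omega> * real L"
    have W_ge: "\<omega> * a * real q \<le> W" using L(1) \<omega> by (simp add: W_def mult.assoc)
    have "1 / \<kappa> \<le> \<omega> * a * real q"
    proof -
      have "1 / (\<kappa> * \<omega> * a) \<le> real q" using N(4) Nq by linarith
      then show ?thesis using a \<omega> \<kappa> by (simp add: field_simps)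
    qed
    then have W: "1 / \<kappa> \<le> W" using W_ge by linarith
    define \<eta> where "\<eta> = 8 / W + 9 * \<Lambda> * of_nat L * \<bar>\<alpha> - \<alpha>'\<bar>"
    have wa: "0 < \<omega> * a * real q" using \<omega> a q by simp
    then have "0 < W" using W_ge by linarith
    then have \<eta>0: "0 \<le> \<eta>" using \<Lambda> by (simp add: \<eta>_def)
    have "\<eta> \<le> 8 / (\<omega> * a * real q) + 9 * \<Lambda> * (2 * a * real q) * (1 / (real q)\<^sup>2)"
    proof -
      have "8 / W \<le> 8 / (\<omega> * a * real q)" using W_ge wa by (intro frac_le) auto
      moreover have "9 * \<Lambda> * real L * \<bar>\<alpha> - \<alpha>'\<bar> \<le> 9 * \<Lambda> * (2 * a * real q) * (1 / (real q)\<^sup>2)"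
        using \<Lambda> L2 q(4) a by (intro mult_mono) auto
      ultimately show ?thesis unfolding \<eta>_def by linarith
    qed
    then have "4 * real q * \<eta> \<le> 4 * real q * (8 / (\<omega> * a * real q) + 9 * \<Lambda> * (2 * a * real q) * (1 / (real q)\<^sup>2))"
      by (intro mult_left_mono) auto
    also have "\<dots> = 32 / (\<omega> * a) + 72 * \<Lambda> * a"
      using q(1) a \<omega>(1) by (simp add: field_simps power2_eq_square)
    also have "\<dots> \<le> e" using a(2) \<omega>(2) by simp
    finally have small: "4 * real q * \<eta> \<le> e" .
    let ?F = "approx_spectrum {x\<^sub>0} (H \<alpha>')"
    have F: "finite ?F" "card ?F \<le> 2 * q" using card_fibre_spectrum[OF q(1) zero q(3)] by auto
    have "measure lebesgue (sp \<alpha>) \<le> measure lebesgue (sp \<alpha>') + 2 * \<eta> * card ?F"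
    proof (rule measure_neighbourhood_le[OF compact_sp F(1) _ sets_sp _ _ \<eta>0])
      show "?F \<subseteq> sp \<alpha>'" by (rule approx_spectrum_mono) simp
      show "\<exists>x\<in>?F. E1 \<le> x \<and> x \<le> E2"
        if "E1 \<notin> sp \<alpha>'" "E2 \<notin> sp \<alpha>'" "E \<in> sp \<alpha>'" "E1 \<le> E" "E \<le> E2" for E1 E2 E
        using that by (rule fibre_meets)
      show "\<exists>y\<in>sp \<alpha>'. \<bar>y - x\<bar> \<le> \<eta>" if "x \<in> sp \<alpha>" for x
        unfolding \<eta>_def using \<kappa> W _ that
      proof (rule localisation)
        show "W \<le> (\<Sum>k<L. 1 / max \<bar>b (\<theta> + of_nat k * \<alpha>)\<bar> \<kappa>)" for \<theta>
          unfolding W_def by (rule win[OF L0])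
      qed
    qed
    also have "2 * \<eta> * card ?F \<le> 2 * \<eta> * (2 * real q)"
      using F(2) \<eta>0 by (intro mult_left_mono) auto
    also have "\<dots> \<le> e" using small by (simp add: mult_ac)
    finally show ?thesis by (simp add: \<alpha>'_def)
  qed
  then show ?thesis unfolding eventually_sequentially by blast
qed

end

theorem theorem1p3:
  fixes b v :: "real \<Rightarrow> real" and \<alpha> :: real
  assumes "b C1_differentiable_on UNIV" and "v C1_differentiable_on UNIV"
    and "\<forall>x. b (x + 1) = b x" and "\<forall>x. v (x + 1) = v x"
    and "\<exists>x. b x = 0" and "finite {x \<in> {0..<1}. b x = 0}"
    and "\<alpha> \<notin> \<rat>"
  shows "\<exists>r :: nat \<Rightarrow> nat. strict_mono r \<and> (\<forall>j. 1 \<le> r j) \<and>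
     (\<lambda>j. measure lebesgue (jacobi_sum_spectrum v b (cf_convergent (r j) \<alpha>)))
       \<longlonglongrightarrow> measure lebesgue (jacobi_sum_spectrum v b \<alpha>)"
proof -
  obtain B1 L1 where b: "\<And>x. \<bar>b x\<bar> \<le> B1" "\<And>x y. \<bar>b x - b y\<bar> \<le> L1 * \<bar>x - y\<bar>"
    using periodic_C1_bounds[OF assms(1,3)] by blast
  obtain B2 L2 where v: "\<And>x. \<bar>v x\<bar> \<le> B2" "\<And>x y. \<bar>v x - v y\<bar> \<le> L2 * \<bar>x - y\<bar>"
    using periodic_C1_bounds[OF assms(2,4)] by blast
  interpret quasiperiodic b v "max B1 B2" "max L1 L2"
  proof
    fix x y
    show "b (x + 1) = b x" "v (x + 1) = v x" using assms by auto
    show "\<bar>b x\<bar> \<le> max B1 B2" "\<bar>v x\<bar> \<le> max B1 B2" using b(1)[of x] v(1)[of x] by auto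
    have "L1 * \<bar>x - y\<bar> \<le> max L1 L2 * \<bar>x - y\<bar>" "L2 * \<bar>x - y\<bar> \<le> max L1 L2 * \<bar>x - y\<bar>"
      by (intro mult_right_mono; simp)+
    then show "\<bar>b x - b y\<bar> \<le> max L1 L2 * \<bar>x - y\<bar>" "\<bar>v x - v y\<bar> \<le> max L1 L2 * \<bar>x - y\<bar>"
      using b(2)[of x y] v(2)[of x y] by linarith+
  qed
  obtain x\<^sub>0 where x\<^sub>0: "b x\<^sub>0 = 0" using assms(5) by blast
  have "(\<lambda>n. measure lebesgue (sp (cf_convergent n \<alpha>))) \<longlonglongrightarrow> measure lebesgue (sp \<alpha>)"
  proof (rule tendstoI)
    fix e :: real assume e: "e > 0"
    then have "e / 2 > 0" by simp
    from eventually_conj[OF limsup_measure[OF assms(7) this] liminf_measure[OF assms(7) x\<^sub>0 this]]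
    show "\<forall>\<^sub>F n in sequentially. dist (measure lebesgue (sp (cf_convergent n \<alpha>))) (measure lebesgue (sp \<alpha>)) < e"
      by (rule eventually_mono) (use e in \<open>simp add: dist_real_def abs_less_iff\<close>)
  qed
  \<comment> \<open>The shift to \<open>Suc j\<close> drops the convergent of index 0, as the
    indices have to be at least 1.\<close>
  then have "(\<lambda>j. measure lebesgue (jacobi_sum_spectrum v b (cf_convergent (Suc j) \<alpha>)))
      \<longlonglongrightarrow> measure lebesgue (jacobi_sum_spectrum v b \<alpha>)"
    unfolding spectrum_eq by (rule LIMSEQ_Suc)
  then show ?thesis by (intro exI[of _ Suc]) (simp add: strict_mono_def)
qed

end
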